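(* Let $K$ be a compact polar set in a domain $D\subset\mathbb{C}$ and let $f$ be holomorphic on $D\setminus K$. Then there exists a continuous plurisubharmonic function $u$ on $D\times\mathbb{C}$ such that $$\{(z,w)\in D\times\mathbb{C}:u(z,w)=-\infty\}=\{(z,f(z)):z\in D\setminus K\}\cup(K\times\mathbb{C}).$$
   Context: A plurisubharmonic function $u:\Omega\to[-\infty,\infty)$ is called continuous if $e^u:\Omega\to[0,\infty)$ is continuous. *)

theory Defs
  imports "HOL-Analysis.Analysis"
begin

text \<open>Functions with values in [-infinity, infinity) are modelled as ereal-valued
  functions that never take the value +infinity.\<close>

definition usc_on :: "'a::topological_space set \<Rightarrow> ('a \<Rightarrow> ereal) \<Rightarrow> bool" where
  "usc_on S u \<longleftrightarrow> (\<forall>c::ereal. openin (top_of_set S) {z\<in>S. u z < c})"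

text \<open>Sub-mean value inequality on the circle of radius r about a.  For u bounded
  above by a real M on the circle, the circle average of u is
  M - (1/(2 pi)) * integral of (M - u), a well-defined value in [-infinity, infinity).\<close>

definition submean_at :: "(complex \<Rightarrow> ereal) \<Rightarrow> complex \<Rightarrow> real \<Rightarrow> bool" where
  "submean_at u a r \<longleftrightarrow>
     (\<forall>M::real. (\<forall>t. u (a + of_real r * cis t) \<le> ereal M) \<longrightarrow>
        u a \<le> ereal M - enn2ereal (ennreal (1 / (2 * pi)) *
              set_nn_integral lborel {0..2*pi}
                 (\<lambda>t. e2ennreal (ereal M - u (a + of_real r * cis t)))))"

definition subharmonic_on :: "complex set \<Rightarrow> (complex \<Rightarrow> ereal) \<Rightarrow> bool" where
  "subharmonic_on S u \<longleftrightarrow> open S \<and> (\<forall>z\<in>S. u z < \<infinity>) \<and> usc_on S u \<and>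
     (\<forall>a\<in>S. \<exists>\<rho>>0. cball a \<rho> \<subseteq> S \<and> (\<forall>r. 0 < r \<and> r < \<rho> \<longrightarrow> submean_at u a r))"

definition plurisubharmonic_on :: "(complex \<times> complex) set \<Rightarrow> (complex \<times> complex \<Rightarrow> ereal) \<Rightarrow> bool" where
  "plurisubharmonic_on \<Omega> u \<longleftrightarrow> open \<Omega> \<and> (\<forall>p\<in>\<Omega>. u p < \<infinity>) \<and> usc_on \<Omega> u \<and>
     (\<forall>a b. subharmonic_on {\<zeta>. (fst a + \<zeta> * fst b, snd a + \<zeta> * snd b) \<in> \<Omega>}
                             (\<lambda>\<zeta>. u (fst a + \<zeta> * fst b, snd a + \<zeta> * snd b)))"

fun eexp :: "ereal \<Rightarrow> real" where
  "eexp (ereal x) = exp x"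
| "eexp MInfty = 0"
| "eexp PInfty = 0"

definition continuous_psh_on :: "(complex \<times> complex) set \<Rightarrow> (complex \<times> complex \<Rightarrow> ereal) \<Rightarrow> bool" where
  "continuous_psh_on \<Omega> u \<longleftrightarrow> plurisubharmonic_on \<Omega> u \<and> continuous_on \<Omega> (\<lambda>p. eexp (u p))"

definition polar :: "complex set \<Rightarrow> bool" where
  "polar E \<longleftrightarrow> (\<exists>u. subharmonic_on UNIV u \<and> (\<exists>z. u z \<noteq> -\<infinity>) \<and> (\<forall>z\<in>E. u z = -\<infinity>))"

end

theory Submission
  imports Defs "HOL-Complex_Analysis.Complex_Analysis"
begin

text \<open>A compact polar set has capacity zero: for every \<open>\<delta> > 0\<close> there is a monic polynomial \<open>q\<close> of
  degree \<open>n\<close> with zeros in \<open>K\<close> and \<open>|q| \<le> \<delta>\<^sup>n\<close> on \<open>K\<close>.  Otherwise the logarithmic potentials of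
  Fekete points would be bounded below near \<open>K\<close>, and comparing them with a subharmonic function
  that is \<open>-\<infinity>\<close> on \<open>K\<close> contradicts the maximum principle.

  Put \<open>\<epsilon> = 2\<delta>\<close> and let \<open>U = {|q| < \<epsilon>\<^sup>n}\<close>, a small neighbourhood of \<open>K\<close>.  Splitting off the principal
  part of \<open>q\<^sup>m f\<close> at \<open>K\<close> by Cauchy integrals over circles in \<open>U\<close> that avoid \<open>K\<close> gives \<open>G\<close>
  holomorphic on \<open>D\<close> with \<open>|q\<^sup>m f - G| \<le> M \<epsilon>\<^bsup>nm\<^esup>\<close> off \<open>U\<close>, where \<open>M\<close> does not depend on \<open>m\<close>; then also
  \<open>|G| \<le> M' \<epsilon>\<^bsup>nm\<^esup>\<close> on \<open>U\<close>.  Hence for large \<open>m\<close> the function \<open>log |q\<^sup>m w - G| / (nm)\<close> is about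
  \<open>log \<epsilon>\<close> on the graph of \<open>f\<close> and on \<open>K \<times> \<complex>\<close>, whereas it stays bounded on compact sets disjoint from
  both.  A suitably normalised series of truncations of such functions, with \<open>\<epsilon>\<close> tending to 0 very
  fast, is the required \<open>u\<close>.\<close>

subsection \<open>Mean values and the maximum principle\<close>

lemma Re_holomorphic_mean_value:
  assumes hol: "\<phi> holomorphic_on ball a R" and r: "0 < r" "r < R"
  shows "((\<lambda>t. Re (\<phi> (a + of_real r * cis t))) has_integral 2 * pi * Re (\<phi> a)) {0..2*pi}"
proof -
  have "cball a r \<subseteq> ball a R" using r by auto
  then have "\<phi> holomorphic_on cball a r" using hol holomorphic_on_subset by blast
  then have "((\<lambda>u. \<phi> u / (u - a)) has_contour_integral 2 * of_real pi * \<i> * \<phi> a) (circlepath a r)"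
    by (rule Cauchy_integral_circlepath_simple) (use r in auto)
  then have "((\<lambda>t. \<phi> (a + r * cis t) / (r * cis t) * r * \<i> * cis t)
      has_integral 2 * of_real pi * \<i> * \<phi> a) {0..2*pi}"
    unfolding circlepath_def by (subst (asm) has_contour_integral_part_circlepath_iff) auto
  then have "((\<lambda>t. - \<i> * (\<phi> (a + r * cis t) / (r * cis t) * r * \<i> * cis t))
      has_integral - \<i> * (2 * of_real pi * \<i> * \<phi> a)) {0..2*pi}"
    by (rule has_integral_mult_right)
  then have "((\<lambda>t. \<phi> (a + r * cis t)) has_integral 2 * of_real pi * \<phi> a) {0..2*pi}"
    using r by (simp add: field_simps)
  from has_integral_linear[OF this bounded_linear_Re] show ?thesis
    by (simp add: o_def)
qed

text \<open>A zero-free function on a disc is \<open>exp \<phi>\<close> with \<open>\<phi>\<close>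
  holomorphic, so ln |g| = Re \<phi> and the previous mean value property applies.\<close>

lemma ln_norm_holomorphic_mean_value:
  assumes hol: "g holomorphic_on ball a R" and nz: "\<And>z. z \<in> ball a R \<Longrightarrow> g z \<noteq> 0"
    and r: "0 < r" "r < R"
  shows "((\<lambda>t. ln (cmod (g (a + of_real r * cis t)))) has_integral 2 * pi * ln (cmod (g a))) {0..2*pi}"
proof -
  obtain \<phi> where \<phi>: "\<phi> holomorphic_on ball a R" and g: "\<And>z. z \<in> ball a R \<Longrightarrow> g z = exp (\<phi> z)"
    by (rule contractible_imp_holomorphic_log[OF hol _ nz])
       (auto simp: convex_imp_contractible)
  have "ln (cmod (g z)) = Re (\<phi> z)" if "z \<in> ball a R" for z
    using g[OF that] by simp
  moreover have "a + of_real r * cis t \<in> ball a R" for t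
    using r by (simp add: dist_norm norm_mult)
  moreover have "a \<in> ball a R" using r by simp
  ultimately show ?thesis
    using Re_holomorphic_mean_value[OF \<phi> r] by simp
qed

text \<open>Bridge between the nonnegative Lebesgue integral in \<open>submean_at\<close> and the
  gauge integrals in which the mean values are computed.\<close>

lemma nn_integral_circle_continuous:
  fixes k :: "real \<Rightarrow> real"
  assumes k: "continuous_on {0..2*pi} k" and nn: "\<And>t. t \<in> {0..2*pi} \<Longrightarrow> 0 \<le> k t"
  shows "set_nn_integral lborel {0..2*pi} (\<lambda>t. ennreal (k t)) = ennreal (integral {0..2*pi} k)"
proof -
  have int: "(k has_integral integral {0..2*pi} k) {0..2*pi}"
    using integrable_continuous_interval[OF k] by blast
  have "(\<lambda>t. indicator {0..2*pi} t *\<^sub>R k t) \<in> borel_measurable borel"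
    using k by (intro borel_measurable_continuous_on_indicator) auto
  then have m: "(\<lambda>t. k t * indicator {0..2*pi} t) \<in> borel_measurable borel"
    by (simp add: mult.commute)
  have i2: "((\<lambda>t. k t * indicator {0..2*pi} t) has_integral integral {0..2*pi} k) UNIV"
    by (rule has_integral_eq[OF _ has_integral_restrict_UNIV[THEN iffD2, OF int]]) (auto simp: indicator_def)
  have "(\<integral>\<^sup>+ t. ennreal (k t * indicator {0..2*pi} t) \<partial>lborel) = ennreal (integral {0..2*pi} k)"
    using nn by (intro nn_integral_has_integral_lborel[OF m _ i2]) (auto simp: indicator_def)
  then show ?thesis
    by (simp add: ennreal_mult'' ennreal_indicator[symmetric] indicator_mult_ennreal flip: )
qed

text \<open>For continuous circle values \<open>k\<close> the bound \<open>M\<close> cancels: M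
  minus the mean of M - k is the mean of k, whatever M is.\<close>

lemma submean_at_continuousI:
  assumes ua: "u a \<le> ereal x" and uc: "\<And>t. u (a + of_real r * cis t) = ereal (k t)"
    and k: "continuous_on {0..2*pi} k" and le: "2 * pi * x \<le> integral {0..2*pi} k"
  shows "submean_at u a r"
  unfolding submean_at_def
proof (intro allI impI)
  fix M assume M: "\<forall>t. u (a + complex_of_real r * cis t) \<le> ereal M"
  have kM: "k t \<le> M" for t using M uc[of t] by (metis ereal_less_eq(3))
  have ki: "k integrable_on {0..2*pi}" by (rule integrable_continuous_interval[OF k])
  have "e2ennreal (ereal M - u (a + of_real r * cis t)) = ennreal (M - k t)" for t
    by (simp add: uc ennreal.abs_eq[symmetric] e2ennreal_ereal)
  then have "set_nn_integral lborel {0..2*pi} (\<lambda>t. e2ennreal (ereal M - u (a + of_real r * cis t)))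
     = set_nn_integral lborel {0..2*pi} (\<lambda>t. ennreal (M - k t))" by simp
  also have "\<dots> = ennreal (integral {0..2*pi} (\<lambda>t. M - k t))"
    by (rule nn_integral_circle_continuous) (use k kM in \<open>auto intro!: continuous_intros\<close>)
  also have "integral {0..2*pi} (\<lambda>t. M - k t) = 2 * pi * M - integral {0..2*pi} k"
    using ki by (subst integral_diff) auto
  finally have "ennreal (1 / (2 * pi)) * set_nn_integral lborel {0..2*pi}
      (\<lambda>t. e2ennreal (ereal M - u (a + of_real r * cis t)))
      = ennreal (1 / (2 * pi) * (2 * pi * M - integral {0..2*pi} k))"
    by (simp add: ennreal_mult'[symmetric])
  moreover have nn: "0 \<le> 1 / (2 * pi) * (2 * pi * M - integral {0..2*pi} k)"
  proof -
    have "integral {0..2*pi} k \<le> integral {0..2*pi} (\<lambda>t. M)"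
      by (rule integral_le) (use ki kM in auto)
    then show ?thesis by simp
  qed
  ultimately have "ereal M - enn2ereal (ennreal (1 / (2 * pi)) * set_nn_integral lborel {0..2*pi}
      (\<lambda>t. e2ennreal (ereal M - u (a + of_real r * cis t))))
      = ereal (M - 1 / (2 * pi) * (2 * pi * M - integral {0..2*pi} k))"
    by (simp add: enn2ereal_ennreal)
  moreover have "x \<le> M - 1 / (2 * pi) * (2 * pi * M - integral {0..2*pi} k)"
    using le by (simp add: field_simps)
  ultimately show "u a \<le> ereal M - enn2ereal (ennreal (1 / (2 * pi)) * set_nn_integral lborel {0..2*pi}
      (\<lambda>t. e2ennreal (ereal M - u (a + of_real r * cis t))))"
    using ua order_trans by (metis ereal_less_eq(3))
qed

text \<open>A subharmonic function is only semicontinuous on the circle. Bounding it by a continuous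
  \<open>k\<close> first means that only the mean of \<open>k\<close> has to be evaluated.\<close>

lemma submean_at_continuousD:
  assumes sm: "submean_at u a r" and uc: "\<And>t. u (a + of_real r * cis t) \<le> ereal (k t)"
    and k: "continuous_on UNIV k" "\<And>t. k t \<le> M"
  shows "u a \<le> ereal (integral {0..2*pi} k / (2 * pi))"
proof -
  have ki: "k integrable_on {0..2*pi}"
    by (rule integrable_continuous_interval) (use k in \<open>auto intro: continuous_on_subset\<close>)
  have uM: "\<forall>t. u (a + of_real r * cis t) \<le> ereal M"
    using uc k(2) by (meson ereal_less_eq(3) order_trans)
  let ?I = "set_nn_integral lborel {0..2*pi} (\<lambda>t. e2ennreal (ereal M - u (a + of_real r * cis t)))"
  have "u a \<le> ereal M - enn2ereal (ennreal (1 / (2 * pi)) * ?I)"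
    using sm uM unfolding submean_at_def by blast
  moreover have "ereal (1 / (2 * pi) * (2 * pi * M - integral {0..2*pi} k)) \<le> enn2ereal (ennreal (1 / (2 * pi)) * ?I)"
  proof -
    have "ennreal (M - k t) \<le> e2ennreal (ereal M - u (a + of_real r * cis t))" for t
    proof -
      have "ereal (M - k t) \<le> ereal M - u (a + of_real r * cis t)"
        using uc[of t] by (metis ereal_minus(1) ereal_minus_mono order_refl)
      then show ?thesis by (metis e2ennreal_ereal e2ennreal_mono)
    qed
    then have "set_nn_integral lborel {0..2*pi} (\<lambda>t. ennreal (M - k t)) \<le> ?I"
      by (intro nn_integral_mono mult_right_mono) auto
    moreover have "set_nn_integral lborel {0..2*pi} (\<lambda>t. ennreal (M - k t)) = ennreal (integral {0..2*pi} (\<lambda>t. M - k t))"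
      by (rule nn_integral_circle_continuous) (use k in \<open>auto intro!: continuous_intros intro: continuous_on_subset\<close>)
    moreover have "integral {0..2*pi} (\<lambda>t. M - k t) = 2 * pi * M - integral {0..2*pi} k"
      using ki by (subst integral_diff) auto
    ultimately have "ennreal (2 * pi * M - integral {0..2*pi} k) \<le> ?I" by simp
    then have "ennreal (1 / (2 * pi)) * ennreal (2 * pi * M - integral {0..2*pi} k) \<le> ennreal (1 / (2 * pi)) * ?I"
      by (intro mult_left_mono) auto
    then have "ennreal (1 / (2 * pi) * (2 * pi * M - integral {0..2*pi} k)) \<le> ennreal (1 / (2 * pi)) * ?I"
      by (subst ennreal_mult') auto
    then show ?thesis
      by (smt (verit) enn2ereal_ennreal enn2ereal_nonneg ereal_less_eq(5) le_ennreal_iff less_eq_ennreal.rep_eq nle_le order_trans)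
  qed
  ultimately have "u a \<le> ereal M - ereal (1 / (2 * pi) * (2 * pi * M - integral {0..2*pi} k))"
    using ereal_minus_mono order_trans order_refl by meson
  then show ?thesis by (simp add: field_simps)
qed

text \<open>If no point were maximal, each \<open>a\<close> would be beaten by some
  \<open>y a\<close>, which by semicontinuity also beats all points of X near \<open>a\<close>.
  Finitely many such neighbourhoods cover X, and the best of the corresponding \<open>y c\<close>
  would be beaten by another one of them.\<close>

lemma usc_plus_continuous_attains_max:
  fixes s :: "'a::metric_space \<Rightarrow> ereal" and h :: "'a \<Rightarrow> real"
  assumes X: "compact X" "X \<noteq> {}" and usc: "usc_on UNIV s" and fin: "\<And>z. s z < \<infinity>"
    and h: "continuous_on X h"
  shows "\<exists>a\<in>X. \<forall>z\<in>X. s z + ereal (h z) \<le> s a + ereal (h a)"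
proof (rule ccontr)
  define w where "w = (\<lambda>z. s z + ereal (h z))"
  assume "\<not> (\<exists>a\<in>X. \<forall>z\<in>X. s z + ereal (h z) \<le> s a + ereal (h a))"
  then have "\<forall>a\<in>X. \<exists>z. z \<in> X \<and> w a < w z" unfolding w_def by (meson not_le)
  then obtain y where y: "\<And>a. a \<in> X \<Longrightarrow> y a \<in> X" "\<And>a. a \<in> X \<Longrightarrow> w a < w (y a)" by metis
  have "\<exists>T. open T \<and> a \<in> T \<and> (\<forall>z\<in>X \<inter> T. w z < w (y a))" if a: "a \<in> X" for a
  proof -
    have "w (y a) \<noteq> \<infinity>" using fin[of "y a"] unfolding w_def by auto
    moreover have "w (y a) \<noteq> -\<infinity>" using y(2)[OF a] by auto
    ultimately obtain c where c: "w (y a) = ereal c" by (cases "w (y a)") auto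
    \<comment> \<open>The gap between \<open>w a\<close> and \<open>c\<close> is divided at
      \<open>v\<close>: near \<open>a\<close>, \<open>s\<close> stays below v - h a, while
      \<open>h\<close> varies by less than c - v.\<close>
    obtain v where v: "w a < ereal v" "v < c" using ereal_dense2[of "w a" "w (y a)"] y(2)[OF a] c by auto
    have sa: "s a < ereal (v - h a)" using v(1) unfolding w_def by (cases "s a") auto
    have "open {z. s z < ereal (v - h a)}" using usc unfolding usc_on_def by auto
    moreover obtain d where d: "d > 0" "\<And>z. z \<in> X \<Longrightarrow> dist z a < d \<Longrightarrow> dist (h z) (h a) < c - v"
      using h a v(2) unfolding continuous_on_iff by (metis diff_gt_0_iff_gt)
    moreover have "w z < w (y a)" if "z \<in> X" "s z < ereal (v - h a)" "dist z a < d" for z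
      using that d(2)[of z] unfolding c by (cases "s z") (auto simp: w_def dist_real_def)
    ultimately show ?thesis using sa
      by (intro exI[of _ "{z. s z < ereal (v - h a)} \<inter> ball a d"]) (auto simp: dist_commute)
  qed
  then obtain T where T: "\<And>a. a \<in> X \<Longrightarrow> open (T a)" "\<And>a. a \<in> X \<Longrightarrow> a \<in> T a"
      "\<And>a z. a \<in> X \<Longrightarrow> z \<in> X \<inter> T a \<Longrightarrow> w z < w (y a)" by metis
  obtain C where C: "C \<subseteq> X" "finite C" "X \<subseteq> (\<Union>c\<in>C. T c)"
    by (rule compactE_image[OF X(1), of X T]) (use T in auto)
  have "C \<noteq> {}" using C(3) X(2) by auto
  then have "Max ((\<lambda>c. w (y c)) ` C) \<in> (\<lambda>c. w (y c)) ` C" using C(2) by (intro Max_in) auto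
  then obtain m where m: "m \<in> C" "w (y m) = Max ((\<lambda>c. w (y c)) ` C)" by auto
  have mx: "w (y c) \<le> w (y m)" if "c \<in> C" for c unfolding m(2) using that C(2) by simp
  obtain c where "c \<in> C" "y m \<in> T c" using C m y(1) by blast
  then show False using T(3)[of c "y m"] mx[of c] C(1) m(1) y(1) by force
qed

text \<open>At a maximum of s + h, \<open>s\<close> is bounded on small circles by s a + h a - h.
  The harmonic part of \<open>h\<close> averages to its value at \<open>a\<close>, so the mean of
  this bound is s a - \<tau> r^2, which contradicts the submean inequality.\<close>

lemma strict_maximum_principle:
  assumes sh: "subharmonic_on UNIV s" and a: "s a \<noteq> -\<infinity>" and \<rho>: "0 < \<rho>"
    and max: "\<And>z. z \<in> ball a \<rho> \<Longrightarrow> s z + ereal (h z) \<le> s a + ereal (h a)"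
    and \<Phi>: "\<Phi> holomorphic_on ball a \<rho>" and \<tau>: "\<tau> > 0"
    and h: "\<And>z. z \<in> ball a \<rho> \<Longrightarrow> h z = Re (\<Phi> z) + \<tau> * (cmod (z - a))\<^sup>2"
  shows False
proof -
  obtain \<rho>' where \<rho>': "\<rho>' > 0" "\<And>r. 0 < r \<Longrightarrow> r < \<rho>' \<Longrightarrow> submean_at s a r"
    using sh unfolding subharmonic_on_def by blast
  define r where "r = min \<rho> \<rho>' / 2"
  have r: "0 < r" "r < \<rho>" "r < \<rho>'" using \<rho> \<rho>' by (auto simp: r_def)
  have "s a < \<infinity>" using sh unfolding subharmonic_on_def by auto
  then obtain x where x: "s a = ereal x" using a by (cases "s a") auto
  have circ: "a + of_real r * cis t \<in> sphere a r" for t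
    using r by (simp add: dist_norm norm_mult)
  have sub: "sphere a r \<subseteq> ball a \<rho>" using r by auto
  define k where "k = (\<lambda>t. x + h a - (Re (\<Phi> (a + of_real r * cis t)) + \<tau> * r\<^sup>2))"
  have c\<Phi>: "continuous_on (sphere a r) \<Phi>"
    using \<Phi> sub holomorphic_on_imp_continuous_on continuous_on_subset by blast
  have "compact (\<Phi> ` sphere a r)" using c\<Phi> by (intro compact_continuous_image) auto
  then obtain b where b: "\<And>z. z \<in> sphere a r \<Longrightarrow> cmod (\<Phi> z) \<le> b"
    using compact_imp_bounded bounded_iff by (metis image_eqI)
  have "s a \<le> ereal (integral {0..2*pi} k / (2 * pi))"
  proof (rule submean_at_continuousD[OF \<rho>'(2)])
    fix t
    let ?z = "a + of_real r * cis t"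
    have "h ?z = Re (\<Phi> ?z) + \<tau> * r\<^sup>2" using h[of ?z] circ[of t] sub r by (auto simp: norm_mult)
    moreover have "s ?z + ereal (h ?z) \<le> ereal (x + h a)" using max[of ?z] circ[of t] sub x by auto
    ultimately show "s ?z \<le> ereal (k t)" unfolding k_def
      by (cases "s ?z") auto
  next
    have "continuous_on UNIV (\<lambda>t. \<Phi> (a + of_real r * cis t))"
      by (rule continuous_on_compose2[OF c\<Phi>]) (use circ in \<open>auto intro!: continuous_intros\<close>)
    then show "continuous_on UNIV k" unfolding k_def by (intro continuous_intros)
  next
    fix t show "k t \<le> x + h a + b"
      using b[OF circ[of t]] abs_Re_le_cmod[of "\<Phi> (a + of_real r * cis t)"] \<tau>
      unfolding k_def by (smt (verit) mult_nonneg_nonneg zero_le_power2)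
  qed (use r in auto)
  moreover have "(k has_integral (x + h a - \<tau> * r\<^sup>2) * (2 * pi) - 2 * pi * Re (\<Phi> a)) {0..2*pi}"
  proof -
    have "((\<lambda>t. (x + h a - \<tau> * r\<^sup>2) - Re (\<Phi> (a + of_real r * cis t))) has_integral
        (x + h a - \<tau> * r\<^sup>2) * (2 * pi) - 2 * pi * Re (\<Phi> a)) {0..2*pi}"
      using has_integral_diff[OF has_integral_const_real[of "x + h a - \<tau> * r\<^sup>2" 0 "2*pi"]
         Re_holomorphic_mean_value[OF \<Phi> r(1,2)]] by (simp add: mult.commute)
    then show ?thesis unfolding k_def by (simp add: algebra_simps)
  qed
  then have "integral {0..2*pi} k / (2 * pi) = x - \<tau> * r\<^sup>2"
    using h[of a] \<rho> by (simp add: integral_unique field_simps)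
  moreover have "\<tau> * r\<^sup>2 > 0" using \<tau> r by simp
  ultimately show False using x by auto
qed

subsection \<open>Capacity of polar sets\<close>

text \<open>The product runs over ordered pairs, so it is the square of the absolute Vandermonde
  determinant of the points. Hence removing one point splits off a square.\<close>

definition vandermonde :: "'i set \<Rightarrow> ('i \<Rightarrow> complex) \<Rightarrow> real" where
  "vandermonde I \<zeta> = (\<Prod>i\<in>I. \<Prod>j\<in>I - {i}. cmod (\<zeta> i - \<zeta> j))"

lemma vandermonde_remove:
  assumes I: "finite I" and k: "k \<in> I"
  shows "vandermonde I \<zeta> = (\<Prod>j\<in>I - {k}. cmod (\<zeta> k - \<zeta> j))\<^sup>2 * vandermonde (I - {k}) \<zeta>"
proof -
  have "(\<Prod>i\<in>I - {k}. \<Prod>j\<in>I - {i}. cmod (\<zeta> i - \<zeta> j)) =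
        (\<Prod>i\<in>I - {k}. cmod (\<zeta> i - \<zeta> k) * (\<Prod>j\<in>I - {k} - {i}. cmod (\<zeta> i - \<zeta> j)))"
  proof (rule prod.cong[OF refl])
    fix i assume "i \<in> I - {k}"
    then have "k \<in> I - {i}" "I - {i} - {k} = I - {k} - {i}" using k by auto
    then show "(\<Prod>j\<in>I - {i}. cmod (\<zeta> i - \<zeta> j)) =
        cmod (\<zeta> i - \<zeta> k) * (\<Prod>j\<in>I - {k} - {i}. cmod (\<zeta> i - \<zeta> j))"
      using prod.remove[of "I - {i}" k "\<lambda>j. cmod (\<zeta> i - \<zeta> j)"] I by simp
  qed
  also have "\<dots> = (\<Prod>j\<in>I - {k}. cmod (\<zeta> k - \<zeta> j)) * vandermonde (I - {k}) \<zeta>"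
    unfolding vandermonde_def by (simp add: prod.distrib norm_minus_commute)
  finally show ?thesis
    unfolding vandermonde_def using prod.remove[OF I k, of "\<lambda>i. \<Prod>j\<in>I - {i}. cmod (\<zeta> i - \<zeta> j)"]
    by (simp add: power2_eq_square)
qed

lemma vandermonde_pos_iff:
  assumes "finite I" shows "vandermonde I \<zeta> > 0 \<longleftrightarrow> inj_on \<zeta> I"
proof -
  have "vandermonde I \<zeta> \<ge> 0" unfolding vandermonde_def by (intro prod_nonneg ballI) auto
  moreover have "vandermonde I \<zeta> \<noteq> 0 \<longleftrightarrow> inj_on \<zeta> I"
    using assms unfolding vandermonde_def inj_on_def by auto
  ultimately show ?thesis by linarith
qed

text \<open>Maximising the pairwise products only up to a factor spares a compactness argument.\<close>

lemma almost_Fekete_points: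
  fixes I :: "'i set"
  assumes K: "bounded K" "infinite K" and I: "finite I"
  obtains \<zeta> where "inj_on \<zeta> I" "\<zeta> ` I \<subseteq> K"
    "\<And>k z. k \<in> I \<Longrightarrow> z \<in> K \<Longrightarrow>
       (\<Prod>j\<in>I - {k}. cmod (z - \<zeta> j)) \<le> 2 * (\<Prod>j\<in>I - {k}. cmod (\<zeta> k - \<zeta> j))"
proof -
  define S where "S = {vandermonde I \<zeta> |\<zeta>. \<zeta> ` I \<subseteq> K}"
  obtain b where b: "\<And>x y. x \<in> K \<Longrightarrow> y \<in> K \<Longrightarrow> cmod (x - y) \<le> b"
    using bounded_two_points[of K] K(1) by (auto simp: dist_norm)
  have "vandermonde I \<zeta> \<le> (\<Prod>i\<in>I. \<Prod>j\<in>I - {i}. b)" if "\<zeta> ` I \<subseteq> K" for \<zeta>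
    unfolding vandermonde_def using that by (intro prod_mono conjI prod_nonneg b ballI) auto
  then have bdd: "bdd_above S"
    unfolding S_def bdd_above_def by blast
  \<comment> \<open>Infinitely many points in K allow pairwise distinct choices, so the supremum is
    positive.\<close>
  obtain B where B: "B \<subseteq> K" "finite B" "card B = card I"
    using infinite_arbitrarily_large[OF K(2)] by metis
  obtain \<zeta>0 where "bij_betw \<zeta>0 I B" using finite_same_card_bij[OF I B(2)] B(3) by auto
  then have \<zeta>0: "inj_on \<zeta>0 I" "\<zeta>0 ` I \<subseteq> K" using B by (auto simp: bij_betw_def)
  then have "vandermonde I \<zeta>0 \<in> S" "vandermonde I \<zeta>0 > 0"
    using vandermonde_pos_iff[OF I] by (auto simp: S_def)
  then have pos: "Sup S > 0" using cSup_upper[OF _ bdd] by force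
  \<comment> \<open>Moving a single point changes the square of its distance product, so a loss of 4
    in \<open>vandermonde\<close> becomes the factor 2 of the claim.\<close>
  then have "Sup S / 4 < Sup S" by simp
  then obtain v where v: "v \<in> S" "Sup S / 4 < v"
    using less_cSup_iff[OF _ bdd] \<open>vandermonde I \<zeta>0 \<in> S\<close> by (metis empty_iff)
  then obtain \<zeta> where \<zeta>: "v = vandermonde I \<zeta>" "\<zeta> ` I \<subseteq> K" unfolding S_def by auto
  have vpos: "vandermonde I \<zeta> > 0" using v(2) pos \<zeta>(1) by linarith
  show thesis
  proof (rule that[of \<zeta>])
    show "inj_on \<zeta> I" using vpos vandermonde_pos_iff[OF I] by auto
    then have R: "vandermonde (I - {k}) \<zeta> > 0" for k
      using vandermonde_pos_iff[of "I - {k}"] I by (auto intro: inj_on_subset)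
    fix k z assume k: "k \<in> I" and z: "z \<in> K"
    let ?\<xi> = "\<zeta>(k := z)" and ?W = "\<lambda>x. \<Prod>j\<in>I - {k}. cmod (x - \<zeta> j)"
    have "vandermonde (I - {k}) ?\<xi> = vandermonde (I - {k}) \<zeta>"
      unfolding vandermonde_def by (intro prod.cong) auto
    moreover have "(\<Prod>j\<in>I - {k}. cmod (?\<xi> k - ?\<xi> j)) = ?W z" by (intro prod.cong) auto
    ultimately have "vandermonde I ?\<xi> = (?W z)\<^sup>2 * vandermonde (I - {k}) \<zeta>"
      using vandermonde_remove[OF I k, of ?\<xi>] by simp
    moreover have "vandermonde I ?\<xi> \<in> S" unfolding S_def using \<zeta>(2) z by fastforce
    then have "vandermonde I ?\<xi> \<le> Sup S" by (rule cSup_upper[OF _ bdd])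
    moreover have "Sup S < 4 * ((?W (\<zeta> k))\<^sup>2 * vandermonde (I - {k}) \<zeta>)"
      using v(2) \<zeta>(1) vandermonde_remove[OF I k, of \<zeta>] by simp
    ultimately have "(?W z)\<^sup>2 * vandermonde (I - {k}) \<zeta> < (2 * ?W (\<zeta> k))\<^sup>2 * vandermonde (I - {k}) \<zeta>"
      by (simp add: power_mult_distrib)
    then have "(?W z)\<^sup>2 < (2 * ?W (\<zeta> k))\<^sup>2" using R[of k] by simp
    then show "?W z \<le> 2 * ?W (\<zeta> k)"
      by (rule power2_le_imp_le[OF less_imp_le]) (simp add: prod_nonneg)
  qed (use \<zeta> in auto)
qed

text \<open>The sum of the Lagrange basis polynomials has degree below the number of nodes and
  equals 1 at every node.\<close>

lemma Lagrange_partition_of_unity: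
  fixes \<zeta> :: "'i \<Rightarrow> complex"
  assumes I: "finite I" "I \<noteq> {}" and inj: "inj_on \<zeta> I"
  shows "(\<Sum>k\<in>I. \<Prod>j\<in>I - {k}. (z - \<zeta> j) / (\<zeta> k - \<zeta> j)) = 1"
proof -
  define l where "l k = (\<Prod>j\<in>I - {k}. smult (1 / (\<zeta> k - \<zeta> j)) [:- \<zeta> j, 1:])" for k
  have pl: "poly (l k) x = (\<Prod>j\<in>I - {k}. (x - \<zeta> j) / (\<zeta> k - \<zeta> j))" for k x
    unfolding l_def poly_prod by (intro prod.cong) (auto simp: diff_divide_distrib)
  have "degree (l k) < card I" if "k \<in> I" for k
  proof -
    have "degree (l k) \<le> (\<Sum>j\<in>I - {k}. degree (smult (1 / (\<zeta> k - \<zeta> j)) [:- \<zeta> j, 1:]))"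
      unfolding l_def using I by (intro degree_prod_sum_le[unfolded o_def]) auto
    also have "\<dots> \<le> (\<Sum>j\<in>I - {k}. 1)"
      by (intro sum_mono order_trans[OF degree_smult_le]) auto
    also have "\<dots> < card I" using that I by (simp add: card_gt_0_iff)
    finally show ?thesis .
  qed
  then have deg: "degree (\<Sum>k\<in>I. l k) < card I"
    using I by (intro degree_sum_less) (auto simp: card_gt_0_iff)
  have "(\<Sum>k\<in>I. l k) = 1"
  proof (rule poly_eqI_degree[of "\<zeta> ` I"])
    show "card (\<zeta> ` I) > degree (\<Sum>k\<in>I. l k)" "card (\<zeta> ` I) > degree (1 :: complex poly)"
      using deg I by (auto simp: card_image[OF inj] card_gt_0_iff)
    fix x assume "x \<in> \<zeta> ` I"
    then obtain i where i: "i \<in> I" "x = \<zeta> i" by auto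
    have "poly (l k) x = (if k = i then 1 else 0)" if "k \<in> I" for k
    proof (cases "k = i")
      case True
      have "\<zeta> i \<noteq> \<zeta> j" if "j \<in> I - {i}" for j using inj i that by (auto simp: inj_on_def)
      then show ?thesis using True i unfolding pl by (auto intro!: prod.neutral)
    next
      case False
      then show ?thesis unfolding pl using i I by (auto intro!: prod_zero)
    qed
    then show "poly (\<Sum>k\<in>I. l k) x = poly 1 x"
      using i I by (simp add: poly_sum)
  qed
  then have "poly (\<Sum>k\<in>I. l k) z = 1" by simp
  then show ?thesis by (simp add: poly_sum pl)
qed

text \<open>Up to the factor 1 / (z - \<zeta> k), each Lagrange basis polynomial is the full product
  divided by a product of node distances, so its modulus is at most the full product over \<eta> c.
  These \<open>card I\<close> terms add up to 1. Applied to almost Fekete points, this bounds their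
  potential from below at distance \<eta> from K.\<close>

lemma prod_norm_lower_bound:
  fixes \<zeta> :: "'i \<Rightarrow> complex"
  assumes I: "finite I" "I \<noteq> {}" and inj: "inj_on \<zeta> I" and pos: "c > 0" "\<eta> > 0"
    and c: "\<And>k. k \<in> I \<Longrightarrow> c \<le> (\<Prod>j\<in>I - {k}. cmod (\<zeta> k - \<zeta> j))"
    and \<eta>: "\<And>k. k \<in> I \<Longrightarrow> \<eta> \<le> cmod (z - \<zeta> k)"
  shows "\<eta> * c / card I \<le> (\<Prod>j\<in>I. cmod (z - \<zeta> j))"
proof -
  let ?F = "\<Prod>j\<in>I. cmod (z - \<zeta> j)"
  have F: "?F \<ge> 0" by (simp add: prod_nonneg)
  have "1 = cmod (\<Sum>k\<in>I. \<Prod>j\<in>I - {k}. (z - \<zeta> j) / (\<zeta> k - \<zeta> j))"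
    using Lagrange_partition_of_unity[OF I inj] by simp
  also have "\<dots> \<le> (\<Sum>k\<in>I. cmod (\<Prod>j\<in>I - {k}. (z - \<zeta> j) / (\<zeta> k - \<zeta> j)))" by (rule norm_sum)
  also have "\<dots> \<le> (\<Sum>k\<in>I. ?F / (\<eta> * c))"
  proof (rule sum_mono)
    fix k assume k: "k \<in> I"
    have "?F = cmod (z - \<zeta> k) * (\<Prod>j\<in>I - {k}. cmod (z - \<zeta> j))" using I k by (simp add: prod.remove)
    then have "(\<Prod>j\<in>I - {k}. cmod (z - \<zeta> j)) = ?F / cmod (z - \<zeta> k)" using \<eta>[OF k] pos by auto
    also have "\<dots> \<le> ?F / \<eta>" using \<eta>[OF k] pos F by (intro divide_left_mono mult_pos_pos) auto
    finally have "(\<Prod>j\<in>I - {k}. cmod (z - \<zeta> j)) / (\<Prod>j\<in>I - {k}. cmod (\<zeta> k - \<zeta> j)) \<le> ?F / \<eta> / c"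
      using c[OF k] pos F by (intro frac_le) auto
    then show "cmod (\<Prod>j\<in>I - {k}. (z - \<zeta> j) / (\<zeta> k - \<zeta> j)) \<le> ?F / (\<eta> * c)"
      by (simp add: prod_norm[symmetric] norm_divide prod_dividef)
  qed
  finally show ?thesis using pos I by (simp add: field_simps card_gt_0_iff)
qed

text \<open>Shows that the potential of the nodes is harmonic away from them, in the form that
  \<open>strict_maximum_principle\<close> asks for.\<close>

lemma ln_norm_prod_eq_Re:
  fixes \<zeta> :: "'i \<Rightarrow> complex"
  assumes I: "finite I" and nz: "\<And>z i. z \<in> ball a \<rho> \<Longrightarrow> i \<in> I \<Longrightarrow> z \<noteq> \<zeta> i"
  obtains \<phi> where "\<phi> holomorphic_on ball a \<rho>"
    "\<And>z. z \<in> ball a \<rho> \<Longrightarrow> ln (\<Prod>i\<in>I. cmod (z - \<zeta> i)) = Re (\<phi> z)"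
proof -
  have "(\<lambda>z. \<Prod>i\<in>I. z - \<zeta> i) holomorphic_on ball a \<rho>" by (intro holomorphic_intros)
  then obtain \<phi> where \<phi>: "\<phi> holomorphic_on ball a \<rho>"
      "\<And>z. z \<in> ball a \<rho> \<Longrightarrow> (\<Prod>i\<in>I. z - \<zeta> i) = exp (\<phi> z)"
  proof (rule contractible_imp_holomorphic_log)
    show "(\<Prod>i\<in>I. z - \<zeta> i) \<noteq> 0" if "z \<in> ball a \<rho>" for z
      using nz[OF that] I by auto
  qed (auto simp: convex_imp_contractible)
  have "ln (\<Prod>i\<in>I. cmod (z - \<zeta> i)) = Re (\<phi> z)" if "z \<in> ball a \<rho>" for z
    using arg_cong[OF \<phi>(2)[OF that], of cmod] by (simp add: prod_norm)
  with \<phi>(1) show thesis using that by blast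
qed

text \<open>Suppose it fails. With \<open>F\<close> the product of distances to n + 1 almost Fekete
  points, the function s + h with h = B (\<tau> |z|^2 - ln F / (n + 1)) has a maximum on a large
  disc minus the \<eta>-neighbourhood of K. On the outer circle \<open>F\<close> is too large for a
  maximum, at distance \<eta> from K \<open>s\<close> is too negative, and in the interior the
  strict maximum principle forbids it.\<close>

lemma polar_imp_small_polynomial:
  assumes K: "compact K" "K \<noteq> {}" and pol: "polar K" and \<delta>: "\<delta> > 0"
  shows "\<exists>n\<ge>1. \<exists>\<zeta>. (\<forall>i<n. \<zeta> i \<in> K) \<and> (\<forall>z\<in>K. (\<Prod>i<n. cmod (z - \<zeta> i)) \<le> \<delta> ^ n)"
proof (rule ccontr)
  assume neg: "\<not> ?thesis"
  have neg': "\<exists>z\<in>K. \<delta> ^ n < (\<Prod>i<n. cmod (z - \<zeta> i))" if "n \<ge> 1" "\<forall>i<n. \<zeta> i \<in> K" for n \<zeta>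
    using neg that by (meson not_le)
  \<comment> \<open>Restated for arbitrary finite index sets, because it will be applied to {..n}
    with one index left out.\<close>
  have big: "\<exists>z\<in>K. \<delta> ^ card J < (\<Prod>j\<in>J. cmod (z - \<zeta> j))"
    if J: "finite J" "J \<noteq> {}" "\<zeta> ` J \<subseteq> K" for J and \<zeta> :: "nat \<Rightarrow> complex"
  proof -
    obtain b where b: "bij_betw b {0..<card J} J" using ex_bij_betw_nat_finite[OF J(1)] by auto
    have "card J \<ge> 1" using J by (simp add: Suc_le_eq card_gt_0_iff)
    moreover have "\<forall>i<card J. \<zeta> (b i) \<in> K"
      using J(3) b by (auto simp: bij_betw_def image_subset_iff)
    ultimately obtain z where z: "z \<in> K" "\<delta> ^ card J < (\<Prod>i<card J. cmod (z - \<zeta> (b i)))"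
      using neg'[of "card J" "\<lambda>i. \<zeta> (b i)"] by blast
    moreover have "(\<Prod>i<card J. cmod (z - \<zeta> (b i))) = (\<Prod>j\<in>J. cmod (z - \<zeta> j))"
      using prod.reindex_bij_betw[OF b, of "\<lambda>j. cmod (z - \<zeta> j)"] by (simp add: lessThan_atLeast0)
    ultimately show ?thesis by auto
  qed
  \<comment> \<open>For finite K the polynomial with all points of K as zeros vanishes on K.\<close>
  have infK: "infinite K"
  proof
    assume fin: "finite K"
    obtain b where b: "bij_betw b {0..<card K} K" using ex_bij_betw_nat_finite[OF fin] by auto
    have "{0..<card K} \<noteq> {}" using fin K(2) by (simp add: card_gt_0_iff)
    then obtain z where z: "z \<in> K" "\<delta> ^ card K < (\<Prod>j\<in>{0..<card K}. cmod (z - b j))"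
      using big[of "{0..<card K}" b] b by (auto simp: bij_betw_def)
    moreover have "(\<Prod>j\<in>{0..<card K}. cmod (z - b j)) = 0"
      using z(1) b by (auto simp: bij_betw_def)
    ultimately show False using \<delta> by (simp add: not_less)
  qed
  obtain s z0 where s: "subharmonic_on UNIV s" and z0: "s z0 \<noteq> -\<infinity>" and sK: "\<And>z. z \<in> K \<Longrightarrow> s z = -\<infinity>"
    using pol unfolding polar_def by blast
  have usc: "usc_on UNIV s" and sfin: "\<And>z. s z < \<infinity>" using s unfolding subharmonic_on_def by auto
  obtain \<sigma> where \<sigma>: "s z0 = ereal \<sigma>" using z0 sfin[of z0] by (cases "s z0") auto
  obtain R0 where R0: "R0 > 0" "\<And>z. z \<in> K \<Longrightarrow> cmod z \<le> R0"
    using compact_imp_bounded[OF K(1)] bounded_pos by blast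
  \<comment> \<open>\<open>L\<close> bounds ln F / (n + 1) at \<open>z0\<close>, and
    \<open>R\<close> is chosen so that on the circle |z| = R this quotient is at least 2 +
    L.\<close>
  define L where "L = ln (cmod z0 + R0 + 1)"
  define R where "R = R0 + exp 2 * (cmod z0 + R0 + 1)"
  have e2: "exp 2 \<ge> (1::real)" by simp
  have "exp 2 * (cmod z0 + R0 + 1) \<ge> 1 * (cmod z0 + R0 + 1)"
    using R0 e2 by (intro mult_right_mono) auto
  then have R1: "R > R0 + cmod z0" using R0(1) unfolding R_def by simp
  then have R: "R > R0 + cmod z0" "R > 0" using R0(1) norm_ge_zero[of z0] by (auto simp del: norm_ge_zero)
  have "0 < cmod z0 + R0 + 1" using R0(1) norm_ge_zero[of z0] by linarith
  then have lnR: "ln (R - R0) = 2 + L" unfolding R_def L_def by (simp add: ln_mult)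
  have "\<exists>a\<in>cball 0 R. \<forall>z\<in>cball 0 R. s z + ereal 0 \<le> s a + ereal 0"
    by (rule usc_plus_continuous_attains_max[OF _ _ usc sfin]) (use R in auto)
  then obtain a0 where "\<And>z. cmod z \<le> R \<Longrightarrow> s z \<le> s a0" by (force simp: zero_ereal_def[symmetric])
  moreover obtain M where "s a0 \<le> ereal M" using sfin[of a0] by (cases "s a0") auto
  ultimately have M: "\<And>z. cmod z \<le> R \<Longrightarrow> s z \<le> ereal M" using order_trans by blast
  have M\<sigma>: "\<sigma> \<le> M" using M[of z0] \<sigma> R R0 by auto
  \<comment> \<open>\<open>B\<close> exceeds the gap M - \<sigma> between \<open>s z0\<close> and
    the bound \<open>M\<close>, so \<open>s\<close> cannot make up for a loss of 3/2 B or more in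
    \<open>h\<close>.\<close>
  define B where "B = M - \<sigma> + 1"
  have B: "B \<ge> 1" "B > 0" using M\<sigma> unfolding B_def by auto
  \<comment> \<open>The quadratic term makes the comparison strict but contributes at most 1/2 on
    the disc of radius R.\<close>
  define \<tau> where "\<tau> = 1 / (2 * (R\<^sup>2 + 1))"
  have "R\<^sup>2 + 1 > 0" by (simp add: add_nonneg_pos)
  then have \<tau>: "\<tau> > 0" "\<tau> * R\<^sup>2 \<le> 1/2" unfolding \<tau>_def by (auto simp: field_simps)
  \<comment> \<open>Near K the potential costs at most 1 + |ln \<delta>| and the quadratic term at
    most 1/2. After subtracting these and |L|, the depth \<open>T\<close> still leaves 5/2.\<close>
  define T where "T = 4 + \<bar>ln \<delta>\<bar> + \<bar>L\<bar>"
  define Om where "Om = {z. s z < ereal (M - B * T)}"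
  have "open Om" using usc unfolding usc_on_def Om_def by auto
  moreover have "K \<subseteq> Om" using sK unfolding Om_def by auto
  ultimately obtain \<eta> where \<eta>: "\<eta> > 0" "{z. infdist z K \<le> \<eta>} \<subseteq> Om"
    using compact_in_open_separated[OF K(2,1)] by metis
  \<comment> \<open>With this \<open>n\<close> the factors \<eta>/2 and 1/(n + 1) in the lower bound
    for \<open>F\<close> cost at most 1 after division by n + 1.\<close>
  obtain n where n: "ln (2 / \<eta>) + ln (real n + 1) \<le> real n + 1" "n \<ge> 1"
  proof -
    obtain n where n: "real n \<ge> max 1 (4 / \<eta>)" using real_arch_simple by blast
    have "2 / \<eta> * (real n + 1) \<le> (real n + 1) / 2 * (real n + 1)"
      using n by (intro mult_right_mono) auto
    also have "\<dots> \<le> exp (real n + 1)"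
      using exp_lower_Taylor_quadratic[of "real n + 1"] by (simp add: power2_eq_square)
    finally have "ln (2 / \<eta> * (real n + 1)) \<le> ln (exp (real n + 1))"
      using \<eta>(1) by (intro ln_mono) auto
    moreover have "ln (2 / \<eta> * (real n + 1)) = ln (2 / \<eta>) + ln (real n + 1)"
      using \<eta>(1) by (intro ln_mult_pos) auto
    ultimately show thesis using that[of n] n by simp
  qed
  obtain \<zeta> :: "nat \<Rightarrow> complex" where \<zeta>: "inj_on \<zeta> {..n}" "\<zeta> ` {..n} \<subseteq> K"
    "\<And>k z. k \<in> {..n} \<Longrightarrow> z \<in> K \<Longrightarrow>
       (\<Prod>j\<in>{..n} - {k}. cmod (z - \<zeta> j)) \<le> 2 * (\<Prod>j\<in>{..n} - {k}. cmod (\<zeta> k - \<zeta> j))"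
    using almost_Fekete_points[OF compact_imp_bounded[OF K(1)] infK, of "{..n}"] by (metis finite_atMost)
  \<comment> \<open>Leaving out one of the n + 1 nodes leaves n, so the negated claim gives a value
    above \<delta>^n on K. The almost Fekete property transfers it to the omitted node at the cost
    of a factor 2.\<close>
  have W: "\<delta> ^ n / 2 \<le> (\<Prod>j\<in>{..n} - {k}. cmod (\<zeta> k - \<zeta> j))" if k: "k \<in> {..n}" for k
  proof -
    have "card ({..n} - {k}) = n" using k by simp
    moreover have "{..n} - {k} \<noteq> {}"
      using n(2) \<open>card ({..n} - {k}) = n\<close> by (metis card.empty not_one_le_zero)
    ultimately obtain z where "z \<in> K" "\<delta> ^ n < (\<Prod>j\<in>{..n} - {k}. cmod (z - \<zeta> j))"
      using big[of "{..n} - {k}" \<zeta>] \<zeta>(2) by auto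
    then show ?thesis using \<zeta>(3)[OF k, of z] by simp
  qed
  define F where "F = (\<lambda>z. \<Prod>j\<le>n. cmod (z - \<zeta> j))"
  define X where "X = cball 0 R \<inter> {z. \<eta> \<le> infdist z K}"
  define h where "h = (\<lambda>z. B * (\<tau> * (cmod z)\<^sup>2 - ln (F z) / (n + 1)))"
  have cl: "closed {z. \<eta> \<le> infdist z K}"
    by (intro closed_Collect_le continuous_intros)
  have X: "compact X" unfolding X_def by (rule compact_Int_closed[OF compact_cball cl])
  have far: "\<eta> \<le> cmod (z - \<zeta> j)" if "z \<in> X" "j \<le> n" for z j
  proof -
    have "\<zeta> j \<in> K" using \<zeta>(2) that by auto
    then have "infdist z K \<le> dist z (\<zeta> j)" by (rule infdist_le)
    then show ?thesis using that unfolding X_def by (auto simp: dist_norm)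
  qed
  have Fpos: "F z > 0" if "z \<in> X" for z
    unfolding F_def using far[OF that] \<eta>(1) by (intro prod_pos) force
  \<comment> \<open>\<open>s z0\<close> lies only B - 1 below \<open>M\<close>, hence
    \<open>z0\<close> is outside \<open>Om\<close> and farther than \<eta> from K.\<close>
  have z0X: "z0 \<in> X"
  proof -
    have "B * 4 \<le> B * T" using B unfolding T_def by (intro mult_left_mono) auto
    then have "z0 \<notin> Om" using \<sigma> B unfolding Om_def B_def by auto
    then have "\<not> infdist z0 K \<le> \<eta>" using \<eta>(2) by blast
    then show ?thesis using R R0 unfolding X_def by auto
  qed
  have hc: "continuous_on X h"
    unfolding h_def
  proof (intro continuous_intros)
    show "continuous_on X F" unfolding F_def by (intro continuous_intros)
  qed (use Fpos in force)+
  have "\<exists>a\<in>X. \<forall>z\<in>X. s z + ereal (h z) \<le> s a + ereal (h a)"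
    by (rule usc_plus_continuous_attains_max[OF X _ usc sfin hc]) (use z0X in auto)
  then obtain a where a: "a \<in> X" "\<And>z. z \<in> X \<Longrightarrow> s z + ereal (h z) \<le> s a + ereal (h a)" by auto
  have amin: "ereal (\<sigma> + h z0) \<le> s a + ereal (h a)" using a(2)[OF z0X] \<sigma> by simp
  then have sa: "s a \<noteq> -\<infinity>" by auto
  then obtain x where x: "s a = ereal x" using sfin[of a] by (cases "s a") auto
  have xh: "\<sigma> + h z0 \<le> x + h a" using amin x by simp
  have "F z0 \<le> (\<Prod>j\<le>n. cmod z0 + R0 + 1)"
    unfolding F_def
  proof (intro prod_mono conjI)
    fix j assume "j \<in> {..n}"
    then have "cmod (\<zeta> j) \<le> R0" using R0 \<zeta>(2) by auto
    then show "cmod (z0 - \<zeta> j) \<le> cmod z0 + R0 + 1" using norm_triangle_ineq4[of z0 "\<zeta> j"] by linarith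
  qed auto
  then have "ln (F z0) \<le> ln ((cmod z0 + R0 + 1) ^ (n+1))"
    using Fpos[OF z0X] by (simp add: ln_mono)
  also have "\<dots> = (n + 1) * L"
    unfolding L_def using \<open>0 < cmod z0 + R0 + 1\<close> by (simp only: ln_realpow)
  finally have "ln (F z0) / (n + 1) \<le> L" by (simp add: field_simps)
  moreover have "0 \<le> \<tau> * (cmod z0)\<^sup>2" using \<tau> by simp
  ultimately have "B * (- L) \<le> h z0" unfolding h_def using B by (intro mult_left_mono) auto
  with xh have xh': "\<sigma> - B * L \<le> x + h a" by simp
  have ta: "\<tau> * (cmod a)\<^sup>2 \<le> 1/2"
  proof -
    have "(cmod a)\<^sup>2 \<le> R\<^sup>2" using a(1) unfolding X_def by (intro power_mono) auto
    then have "\<tau> * (cmod a)\<^sup>2 \<le> \<tau> * R\<^sup>2" using \<tau> by (intro mult_left_mono) auto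
    then show ?thesis using \<tau> by linarith
  qed
  consider "cmod a = R" | "infdist a K = \<eta>" | "cmod a < R" "infdist a K > \<eta>"
    using a(1) unfolding X_def by force
  then show False
  proof cases
    case 1
    have "(\<Prod>j\<le>n. R - R0) \<le> F a" unfolding F_def
    proof (intro prod_mono conjI)
      fix j assume "j \<in> {..n}"
      then have "cmod (\<zeta> j) \<le> R0" using R0 \<zeta>(2) by auto
      then show "R - R0 \<le> cmod (a - \<zeta> j)" using norm_triangle_ineq2[of a "\<zeta> j"] 1 by linarith
    qed (use R R0 norm_ge_zero[of z0] in linarith)
    moreover have RR: "R - R0 > 0" using R norm_ge_zero[of z0] by linarith
    ultimately have "ln ((R - R0) ^ (n + 1)) \<le> ln (F a)" by (simp add: ln_mono)
    moreover have "ln ((R - R0) ^ (n + 1)) = (n + 1) * (2 + L)"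
      using RR by (simp only: ln_realpow lnR)
    ultimately have "2 + L \<le> ln (F a) / (n + 1)" by (simp add: field_simps)
    then have "h a \<le> B * (1/2 - (2 + L))" unfolding h_def using ta B by (intro mult_left_mono) auto
    moreover have "x \<le> M" using M[of a] 1 x by auto
    ultimately have "\<sigma> - B * L \<le> M + B * (1/2 - (2 + L))" using xh' by linarith
    moreover have "B * (1/2 - (2 + L)) = - (3/2 * B) - B * L" by (simp add: algebra_simps)
    ultimately show False using B B_def by linarith
  next
    case 2
    have "\<eta> * (\<delta> ^ n / 2) / card {..n} \<le> F a"
      unfolding F_def using prod_norm_lower_bound[of "{..n}" \<zeta> "\<delta>^n/2" \<eta> a] \<zeta>(1) W far[OF a(1)] \<eta> \<delta>
      by auto
    then have "ln (\<eta> / 2 * \<delta> ^ n / (n + 1)) \<le> ln (F a)"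
      using \<eta> \<delta> by (intro ln_mono) auto
    moreover have "ln (\<eta> / 2 * \<delta> ^ n / (n + 1)) = ln (\<eta> / 2) + n * ln \<delta> - ln (real n + 1)"
    proof -
      have "ln (\<eta> / 2 * \<delta> ^ n / (real n + 1)) = ln (\<eta> / 2 * \<delta> ^ n) - ln (real n + 1)"
        using \<eta> \<delta> by (intro ln_divide_pos) auto
      moreover have "ln (\<eta> / 2 * \<delta> ^ n) = ln (\<eta> / 2) + ln (\<delta> ^ n)"
        using \<eta> \<delta> by (intro ln_mult_pos) auto
      moreover have "ln (\<delta> ^ n) = n * ln \<delta>" by (rule ln_realpow)
      ultimately show ?thesis by (simp add: add.commute)
    qed
    moreover have "ln (\<eta> / 2) = - ln (2 / \<eta>)" using \<eta> by (simp add: ln_div)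
    ultimately have "- ln (F a) \<le> (real n + 1) - n * ln \<delta>" using n(1) by linarith
    also have "\<dots> \<le> (real n + 1) * (1 + \<bar>ln \<delta>\<bar>)"
    proof -
      have "- (n * ln \<delta>) \<le> real n * \<bar>ln \<delta>\<bar>"
        using mult_left_mono[of "- ln \<delta>" "\<bar>ln \<delta>\<bar>" "real n"] by auto
      then show ?thesis by (simp add: algebra_simps)
    qed
    finally have "- (1 + \<bar>ln \<delta>\<bar>) \<le> ln (F a) / (n + 1)" by (simp add: field_simps)
    then have "h a \<le> B * (1/2 + (1 + \<bar>ln \<delta>\<bar>))" unfolding h_def using ta B by (intro mult_left_mono) auto
    moreover have "a \<in> Om" using 2 \<eta>(2) by auto
    then have "x \<le> M - B * T" using x unfolding Om_def by simp
    ultimately have "\<sigma> - B * L \<le> M - B * T + B * (1/2 + (1 + \<bar>ln \<delta>\<bar>))" using xh' by linarith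
    also have "\<dots> = M - B * (5/2 + \<bar>L\<bar>)" unfolding T_def by (simp add: algebra_simps)
    also have "\<dots> \<le> M - B * (5/2 + L)" using B by (intro diff_left_mono mult_left_mono) auto
    also have "\<dots> = M - 5/2 * B - B * L" by (simp add: algebra_simps)
    finally show False using B B_def by linarith
  next
    case 3
    have "open (ball 0 R \<inter> {z. \<eta> < infdist z K})"
      by (intro open_Int open_ball open_Collect_less continuous_intros)
    moreover have "a \<in> ball 0 R \<inter> {z. \<eta> < infdist z K}" using 3 by auto
    ultimately obtain \<rho> where \<rho>: "\<rho> > 0" "ball a \<rho> \<subseteq> ball 0 R \<inter> {z. \<eta> < infdist z K}"
      using open_contains_ball by metis
    have sub: "ball a \<rho> \<subseteq> X" using \<rho>(2) unfolding X_def by auto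
    obtain \<phi> where \<phi>: "\<phi> holomorphic_on ball a \<rho>" "\<And>z. z \<in> ball a \<rho> \<Longrightarrow> ln (F z) = Re (\<phi> z)"
      using ln_norm_prod_eq_Re[of "{..n}" a \<rho> \<zeta>] far sub \<eta>(1) unfolding F_def
      by (metis atMost_iff diff_self finite_atMost linorder_not_less norm_zero subsetD)
    \<comment> \<open>Since |z|^2 = Re (2 cnj a z) - |a|^2 + |z - a|^2, the quadratic term splits
      into a harmonic part, collected in \<open>\<Phi>\<close>, and a square centred at
      \<open>a\<close>.\<close>
    define \<Phi> where "\<Phi> = (\<lambda>z. of_real B * (of_real \<tau> * (2 * cnj a * z - of_real ((cmod a)\<^sup>2)) - \<phi> z / of_real (n + 1)))"
    show False
    proof (rule strict_maximum_principle[OF s sa \<rho>(1), of h \<Phi> "B * \<tau>"])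
      show "s z + ereal (h z) \<le> s a + ereal (h a)" if "z \<in> ball a \<rho>" for z using a(2) sub that by auto
      show "\<Phi> holomorphic_on ball a \<rho>" unfolding \<Phi>_def by (intro holomorphic_intros \<phi>) auto
      show "B * \<tau> > 0" using B \<tau> by simp
      fix z assume z: "z \<in> ball a \<rho>"
      have "(cmod z)\<^sup>2 = Re (2 * cnj a * z) - (cmod a)\<^sup>2 + (cmod (z - a))\<^sup>2"
        unfolding cmod_power2 by (simp add: power2_eq_square algebra_simps)
      then have "\<tau> * (cmod z)\<^sup>2 = \<tau> * (Re (2 * cnj a * z) - (cmod a)\<^sup>2) + \<tau> * (cmod (z - a))\<^sup>2"
        by (simp only: distrib_left)
      moreover have "Re (\<Phi> z) = B * (\<tau> * (Re (2 * cnj a * z) - (cmod a)\<^sup>2) - ln (F z) / (n + 1))"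
        unfolding \<Phi>_def \<phi>(2)[OF z]
        by (simp only: Re_complex_of_real Re_divide_of_real minus_complex.sel mult.assoc
             times_complex.sel Im_complex_of_real mult_zero_left diff_zero)
      ultimately show "h z = Re (\<Phi> z) + B * \<tau> * (cmod (z - a))\<^sup>2"
        unfolding h_def by (simp add: ring_distribs)
    qed
  qed
qed

subsection \<open>Principal parts at a polar set\<close>

definition cauchy_circle :: "complex \<Rightarrow> real \<Rightarrow> (complex \<Rightarrow> complex) \<Rightarrow> complex \<Rightarrow> complex" where
  "cauchy_circle a r h z = contour_integral (circlepath a r) (\<lambda>\<zeta>. h \<zeta> / (\<zeta> - z)) / (2 * of_real pi * \<i>)"

lemma cauchy_circle_integrable:
  assumes h: "continuous_on (sphere a r) h" and r: "r > 0" and z: "z \<notin> sphere a r"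
  shows "(\<lambda>\<zeta>. h \<zeta> / (\<zeta> - z)) contour_integrable_on circlepath a r"
  using r z by (intro contour_integrable_continuous_circlepath continuous_intros h[folded path_image_circlepath])
     (auto simp: h)

lemma cauchy_circle_holomorphic:
  assumes h: "continuous_on (sphere a r) h" and r: "r > 0"
  shows "cauchy_circle a r h holomorphic_on - sphere a r"
proof -
  let ?g = "\<lambda>z. contour_integral (circlepath a r) (\<lambda>\<zeta>. h \<zeta> / (\<zeta> - z))"
  have "(?g has_field_derivative (1 * contour_integral (circlepath a r) (\<lambda>u. h u / (u - z) ^ Suc 1))) (at z)"
    if "z \<in> - sphere a r" for z
  proof -
    have "(?g has_field_derivative (of_nat 1 * contour_integral (circlepath a r) (\<lambda>u. h u / (u - z) ^ Suc 1))) (at z)"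
    proof (rule Cauchy_next_derivative(2)[where S = UNIV and B = "2 * pi * r"])
      show "continuous_on (path_image (circlepath a r)) h" using h r by simp
      show "cmod (vector_derivative (circlepath a r) (at t)) \<le> 2 * pi * r" if "t \<in> {0..1}" for t
        using r by (simp add: vector_derivative_circlepath norm_mult)
      show "((\<lambda>u. h u / (u - w) ^ 1) has_contour_integral ?g w) (circlepath a r)"
        if "w \<in> UNIV - path_image (circlepath a r)" for w
        using cauchy_circle_integrable[OF h r, of w] that r by (simp add: has_contour_integral_integral)
      show "z \<in> UNIV - path_image (circlepath a r)" using that r by simp
    qed auto
    then show ?thesis by simp
  qed
  then have "?g holomorphic_on - sphere a r"
    using holomorphic_on_open[of "- sphere a r" ?g] open_Compl[OF closed_sphere[of a r]] by blast
  then show ?thesis unfolding cauchy_circle_def[abs_def] by (intro holomorphic_intros) auto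
qed

text \<open>At distance 2 r or more from the centre the denominator is at least r. This r and the 2
  pi of the normalisation cancel the length 2 pi r.\<close>

lemma cauchy_circle_bound:
  assumes h: "continuous_on (sphere a r) h" and r: "r > 0" and z: "dist a z \<ge> 2 * r"
    and B: "\<And>\<zeta>. \<zeta> \<in> sphere a r \<Longrightarrow> cmod (h \<zeta>) \<le> B"
  shows "cmod (cauchy_circle a r h z) \<le> B"
proof -
  have "a + of_real r \<in> sphere a r" using r by (simp add: dist_norm)
  then have B0: "B \<ge> 0" using B norm_ge_zero order_trans by blast
  have "(\<lambda>\<zeta>. h \<zeta> / (\<zeta> - z)) contour_integrable_on circlepath a r"
    using cauchy_circle_integrable[OF h r] z r by auto
  then have "cmod (contour_integral (circlepath a r) (\<lambda>\<zeta>. h \<zeta> / (\<zeta> - z))) \<le> B / r * (2 * pi * r)"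
  proof (rule has_contour_integral_bound_circlepath[OF has_contour_integral_integral])
    fix x assume x: "cmod (x - a) = r"
    have "dist a z \<le> dist a x + dist x z" by (rule dist_triangle)
    then have "r \<le> cmod (x - z)" using x z by (simp add: dist_norm norm_minus_commute)
    moreover have "cmod (h x) \<le> B" using B x by (simp add: dist_norm norm_minus_commute)
    ultimately show "cmod (h x / (x - z)) \<le> B / r" using r B0 by (simp add: norm_divide frac_le)
  qed (use r B0 in auto)
  then show ?thesis unfolding cauchy_circle_def using r by (simp add: norm_divide norm_mult field_simps)
qed

lemma homotopic_circlepaths:
  assumes r: "0 < r1" "r1 \<le> r2" and sub: "cball a r2 - ball a r1 \<subseteq> S"
  shows "homotopic_loops S (circlepath a r1) (circlepath a r2)"
proof (rule homotopic_loops_linear)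
  fix t :: real assume "t \<in> {0..1}"
  show "closed_segment (circlepath a r1 t) (circlepath a r2 t) \<subseteq> S"
  proof
    fix x assume "x \<in> closed_segment (circlepath a r1 t) (circlepath a r2 t)"
    then obtain u where u: "0 \<le> u" "u \<le> 1"
      and x: "x = (1 - u) *\<^sub>R circlepath a r1 t + u *\<^sub>R circlepath a r2 t"
      by (auto simp: closed_segment_def)
    define c where "c = (1 - u) * r1 + u * r2"
    have "x - a = of_real c * exp (2 * of_real pi * \<i> * of_real t)"
      unfolding x circlepath c_def by (simp add: scaleR_conv_of_real algebra_simps)
    then have "dist a x = \<bar>c\<bar>"
      by (simp add: dist_norm norm_minus_commute[of a] norm_mult norm_exp_eq_Re)
    moreover have "r1 \<le> c" "c \<le> r2"
    proof -
      have "c = r1 + u * (r2 - r1)" "c = r2 - (1 - u) * (r2 - r1)" unfolding c_def by (simp_all add: algebra_simps)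
      moreover have "0 \<le> u * (r2 - r1)" "0 \<le> (1 - u) * (r2 - r1)" using u r by auto
      ultimately show "r1 \<le> c" "c \<le> r2" by linarith+
    qed
    ultimately show "x \<in> S" using sub r by auto
  qed
qed auto

text \<open>The difference quotient of \<open>h\<close> at \<open>z\<close> extends holomorphically
  over \<open>z\<close>, so its integrals over the two homotopic circles agree. The remaining term
  with the constant \<open>h z\<close> contributes only on the outer circle, as \<open>z\<close>
  lies outside the inner one.\<close>

lemma cauchy_circle_annulus:
  assumes h: "h holomorphic_on S" and S: "open S" and r: "0 < r1" "r1 < r2"
    and sub: "cball a r2 - ball a r1 \<subseteq> S" and z: "r1 < dist a z" "dist a z < r2"
  shows "h z = cauchy_circle a r2 h z - cauchy_circle a r1 h z"
proof -
  have zS: "z \<in> S" using sub z by auto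
  define k where "k = (\<lambda>\<zeta>. if \<zeta> = z then deriv h z else h \<zeta> / (\<zeta> - z) - h z / (\<zeta> - z))"
  have khol: "k holomorphic_on S"
    unfolding k_def by (rule pole_theorem_open[OF h S]) auto
  have "contour_integral (circlepath a r1) k = contour_integral (circlepath a r2) k"
    by (rule Cauchy_theorem_homotopic_loops[OF homotopic_circlepaths[OF r(1) less_imp_le[OF r(2)] sub] S khol]) auto
  have cont: "continuous_on (sphere a r) h" if "r = r1 \<or> r = r2" for r
    using h sub that r by (intro continuous_on_subset[OF holomorphic_on_imp_continuous_on[OF h]]) auto
  have split: "contour_integral (circlepath a r) k =
      contour_integral (circlepath a r) (\<lambda>\<zeta>. h \<zeta> / (\<zeta> - z)) - contour_integral (circlepath a r) (\<lambda>\<zeta>. h z / (\<zeta> - z))"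
    if rr: "r = r1 \<or> r = r2" for r
  proof -
    have rp: "r > 0" "z \<notin> sphere a r" using rr r z by auto
    have "contour_integral (circlepath a r) k = contour_integral (circlepath a r) (\<lambda>\<zeta>. h \<zeta> / (\<zeta> - z) - h z / (\<zeta> - z))"
      unfolding k_def using rp by (intro contour_integral_eq) auto
    also have "\<dots> = contour_integral (circlepath a r) (\<lambda>\<zeta>. h \<zeta> / (\<zeta> - z)) - contour_integral (circlepath a r) (\<lambda>\<zeta>. h z / (\<zeta> - z))"
      by (intro contour_integral_diff cauchy_circle_integrable[OF cont[OF rr] rp]
          cauchy_circle_integrable[of a r "\<lambda>_. h z", OF continuous_on_const rp])
    finally show ?thesis .
  qed
  have out: "contour_integral (circlepath a r1) (\<lambda>\<zeta>. h z / (\<zeta> - z)) = 0"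
  proof (rule contour_integral_unique[OF Cauchy_theorem_convex_simple])
    show "(\<lambda>\<zeta>. h z / (\<zeta> - z)) holomorphic_on cball a r1" using z by (intro holomorphic_intros) auto
  qed (use r in auto)
  have inn: "contour_integral (circlepath a r2) (\<lambda>\<zeta>. h z / (\<zeta> - z)) = 2 * of_real pi * \<i> * h z"
    using Cauchy_integral_circlepath_simple[of "\<lambda>_. h z" a r2 z] z
    by (intro contour_integral_unique) (auto simp: dist_norm norm_minus_commute)
  have "contour_integral (circlepath a r2) (\<lambda>\<zeta>. h \<zeta> / (\<zeta> - z)) - contour_integral (circlepath a r1) (\<lambda>\<zeta>. h \<zeta> / (\<zeta> - z))
      = 2 * of_real pi * \<i> * h z"
    using \<open>contour_integral (circlepath a r1) k = contour_integral (circlepath a r2) k\<close> split[of r1] split[of r2] out inn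
    by (simp add: algebra_simps)
  then show ?thesis unfolding cauchy_circle_def by (simp add: field_simps)
qed

text \<open>The Cauchy integral over the outer circle continues \<open>G\<close> into the disc, and
  minus the one over the inner circle continues \<open>H\<close> to the exterior. Elsewhere each is
  obtained from \<open>h\<close> by subtraction, and Cauchy's formula on the annulus makes the
  pieces fit. \<open>H\<close> is thus controlled far out by the values of \<open>h\<close> on the
  inner circle alone.\<close>

lemma Laurent_splitting:
  assumes D: "open D" and K: "closed K" and h: "h holomorphic_on D - K"
    and r: "0 < r1" "r1 < r2" and sub: "cball a r2 \<subseteq> D" and ann: "K \<inter> (cball a r2 - ball a r1) = {}"
  obtains G H where "G holomorphic_on D - (K - ball a r1)" "H holomorphic_on - (K \<inter> ball a r1)"
    "\<And>z. z \<in> D - K \<Longrightarrow> h z = G z + H z"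
    "\<And>z B. 2 * r1 \<le> dist a z \<Longrightarrow> r2 \<le> dist a z \<Longrightarrow>
        (\<And>\<zeta>. \<zeta> \<in> sphere a r1 \<Longrightarrow> cmod (h \<zeta>) \<le> B) \<Longrightarrow> cmod (H z) \<le> B"
proof -
  define F1 where "F1 = cauchy_circle a r1 h"
  define F2 where "F2 = cauchy_circle a r2 h"
  define G where "G = (\<lambda>z. if z \<in> ball a r2 then F2 z else h z + F1 z)"
  define H where "H = (\<lambda>z. if z \<in> ball a r2 then h z - F2 z else - F1 z)"
  have S: "open (D - K)" using D K by auto
  have annS: "cball a r2 - ball a r1 \<subseteq> D - K" using sub ann by auto
  have cont: "continuous_on (sphere a r1) h" "continuous_on (sphere a r2) h"
    using annS r by (auto intro!: continuous_on_subset[OF holomorphic_on_imp_continuous_on[OF h]] dest!: subsetD)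
  have F1: "F1 holomorphic_on - cball a r1"
    unfolding F1_def by (rule holomorphic_on_subset[OF cauchy_circle_holomorphic[OF cont(1) r(1)]]) auto
  have F2: "F2 holomorphic_on ball a r2"
    unfolding F2_def using r by (intro holomorphic_on_subset[OF cauchy_circle_holomorphic[OF cont(2)]]) auto
  have overlap: "h z = F2 z - F1 z" if "z \<in> ball a r2 - cball a r1" for z
    unfolding F1_def F2_def using that by (intro cauchy_circle_annulus[OF h S r annS]) auto
  have hG: "(\<lambda>z. h z + F1 z) holomorphic_on (D - K) - cball a r1"
    by (intro holomorphic_intros holomorphic_on_subset[OF h] holomorphic_on_subset[OF F1]) auto
  have "G holomorphic_on ball a r2 \<union> ((D - K) - cball a r1)"
  proof (rule holomorphic_on_Un)
    show "G holomorphic_on ball a r2" by (rule holomorphic_transform[OF F2]) (auto simp: G_def)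
    show "G holomorphic_on (D - K) - cball a r1"
      by (rule holomorphic_transform[OF hG]) (use overlap in \<open>auto simp: G_def\<close>)
  qed (use S in auto)
  moreover have "D - (K - ball a r1) \<subseteq> ball a r2 \<union> ((D - K) - cball a r1)" using r by auto
  ultimately have G: "G holomorphic_on D - (K - ball a r1)" by (rule holomorphic_on_subset)
  have hH: "(\<lambda>z. h z - F2 z) holomorphic_on ball a r2 - K"
    using sub by (intro holomorphic_intros holomorphic_on_subset[OF h] holomorphic_on_subset[OF F2]) auto
  have "H holomorphic_on (ball a r2 - K) \<union> - cball a r1"
  proof (rule holomorphic_on_Un)
    show "H holomorphic_on ball a r2 - K" by (rule holomorphic_transform[OF hH]) (auto simp: H_def)
    have "(\<lambda>z. - F1 z) holomorphic_on - cball a r1" by (intro holomorphic_intros F1)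
    then show "H holomorphic_on - cball a r1"
      by (rule holomorphic_transform) (use overlap in \<open>auto simp: H_def\<close>)
  qed (use K in auto)
  moreover have "- (K \<inter> ball a r1) \<subseteq> (ball a r2 - K) \<union> - cball a r1"
  proof
    fix z assume z: "z \<in> - (K \<inter> ball a r1)"
    show "z \<in> (ball a r2 - K) \<union> - cball a r1"
    proof (cases "z \<in> cball a r1")
      case True
      then have "z \<in> ball a r2" "z \<in> cball a r2" using r by auto
      then show ?thesis using ann z by blast
    qed auto
  qed
  ultimately have H: "H holomorphic_on - (K \<inter> ball a r1)" by (rule holomorphic_on_subset)
  show thesis
  proof (rule that[OF G H])
    show "h z = G z + H z" for z unfolding G_def H_def by auto
    fix z B assume z: "2 * r1 \<le> dist a z" "r2 \<le> dist a z" and B: "\<And>\<zeta>. \<zeta> \<in> sphere a r1 \<Longrightarrow> cmod (h \<zeta>) \<le> B"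
    then show "cmod (H z) \<le> B"
      using cauchy_circle_bound[OF cont(1) r(1) z(1) B] by (simp add: H_def F1_def)
  qed
qed

text \<open>Pulling the radial projection of a small polynomial back along the Joukowski map
  turns it into a polynomial whose value at 0 is too large for the maximum modulus principle.\<close>

lemma polar_avoids_circle:
  assumes K: "compact K" and pol: "polar K" and \<eta>: "\<eta> > 0"
  shows "\<exists>r. 0 < r \<and> r < \<eta> \<and> K \<inter> sphere a r = {}"
proof (cases "K = {}")
  case True
  then show ?thesis using \<eta> by (intro exI[of _ "\<eta>/2"]) auto
next
  case False
  show ?thesis
  proof (rule ccontr)
    assume "\<not> ?thesis"
    then have meet: "\<exists>z\<in>K. dist a z = x" if "0 < x" "x < \<eta>" for x using that by force
    obtain n \<zeta> where n: "n \<ge> 1" and q: "\<And>z. z \<in> K \<Longrightarrow> (\<Prod>i<n. cmod (z - \<zeta> i)) \<le> (\<eta>/16) ^ n"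
      using polar_imp_small_polynomial[OF K False pol, of "\<eta>/16"] \<eta> by auto
    define \<rho> where "\<rho> = (\<lambda>i. dist a (\<zeta> i))"
    \<comment> \<open>Projecting to distances from \<open>a\<close> only shrinks the factors. As K
      meets every circle of radius below \<eta>, the real polynomial with zeros
      \<open>\<rho> i\<close> is small on the whole interval.\<close>
    have px: "(\<Prod>i<n. \<bar>x - \<rho> i\<bar>) \<le> (\<eta>/16) ^ n" if x: "0 < x" "x < \<eta>" for x
    proof -
      obtain z where z: "z \<in> K" "dist a z = x" using meet[OF x] by auto
      have "(\<Prod>i<n. \<bar>x - \<rho> i\<bar>) \<le> (\<Prod>i<n. cmod (z - \<zeta> i))"
      proof (intro prod_mono conjI)
        fix i
        have "\<bar>dist a z - dist a (\<zeta> i)\<bar> \<le> dist z (\<zeta> i)"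
          using abs_dist_diff_le[of z a "\<zeta> i"] by (simp add: dist_commute)
        then show "\<bar>x - \<rho> i\<bar> \<le> cmod (z - \<zeta> i)" using z by (simp add: \<rho>_def dist_norm)
      qed auto
      then show ?thesis using q[OF z(1)] by linarith
    qed
    \<comment> \<open>P(t) is t^n times the product of x(t) - \<rho> i, where x(t) = \<eta>/2 +
      (\<eta>/8)(t + 1/t). On |t| = 1 this x(t) is real and lies between \<eta>/4 and 3\<eta>/4, so
      \<open>px\<close> applies, but P(0) = (\<eta>/8)^n.\<close>
    define P where "P = (\<lambda>t::complex. \<Prod>i<n. of_real (\<eta>/8) * (t\<^sup>2 + 1) + of_real (\<eta>/2 - \<rho> i) * t)"
    have "cmod (P 0) \<le> (\<eta>/16) ^ n"
    proof (rule maximum_modulus_frontier[of P "ball 0 1"])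
      show "P holomorphic_on interior (ball 0 1)" unfolding P_def by (intro holomorphic_intros)
      show "continuous_on (closure (ball 0 1)) P" unfolding P_def by (intro continuous_intros)
      fix t :: complex assume "t \<in> frontier (ball 0 1)"
      then have t: "cmod t = 1" by simp
      have "t * cnj t = 1" using t by (simp add: complex_norm_square[symmetric])
      then have "t\<^sup>2 + 1 = t * (t + cnj t)" by (simp add: power2_eq_square distrib_left)
      also have "t + cnj t = of_real (2 * Re t)" by (simp add: complex_add_cnj)
      finally have t2: "t\<^sup>2 + 1 = t * of_real (2 * Re t)" .
      have "cmod (of_real (\<eta>/8) * (t\<^sup>2 + 1) + of_real (\<eta>/2 - \<rho> i) * t) = \<bar>\<eta>/2 + \<eta>/4 * Re t - \<rho> i\<bar>" for i
      proof -
        have "of_real (\<eta>/8) * (t\<^sup>2 + 1) + of_real (\<eta>/2 - \<rho> i) * t = t * of_real (\<eta>/2 + \<eta>/4 * Re t - \<rho> i)"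
          unfolding t2 by (simp add: field_simps)
        then show ?thesis using t by (simp only: norm_mult norm_of_real mult_1)
      qed
      then have "cmod (P t) = (\<Prod>i<n. \<bar>\<eta>/2 + \<eta>/4 * Re t - \<rho> i\<bar>)"
        unfolding P_def by (simp add: prod_norm[symmetric])
      also have "\<dots> \<le> (\<eta>/16) ^ n"
      proof (rule px)
        have "\<bar>Re t\<bar> \<le> 1" using abs_Re_le_cmod[of t] t by simp
        then have "\<eta>/4 * (-1) \<le> \<eta>/4 * Re t" "\<eta>/4 * Re t \<le> \<eta>/4 * 1"
          using \<eta> by (intro mult_left_mono; simp)+
        then show "0 < \<eta>/2 + \<eta>/4 * Re t" "\<eta>/2 + \<eta>/4 * Re t < \<eta>" using \<eta> by linarith+
      qed
      finally show "cmod (P t) \<le> (\<eta>/16) ^ n" .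
    qed auto
    moreover have "cmod (P 0) = (\<eta>/8) ^ n" unfolding P_def using \<eta> by (simp add: norm_power norm_divide)
    moreover have "(\<eta>/16) ^ n < (\<eta>/8) ^ n" using \<eta> n by (intro power_strict_mono) auto
    ultimately show False by linarith
  qed
qed

text \<open>The distances from \<open>a\<close> to K form a compact set, so a missed radius has a
  whole neighbourhood of missed radii.\<close>

lemma polar_avoids_annulus:
  assumes K: "compact K" and pol: "polar K" and \<eta>: "\<eta> > 0"
  shows "\<exists>r s. 0 < r \<and> r < s \<and> s < \<eta> \<and> K \<inter> (cball a s - ball a r) = {}"
proof -
  obtain r where r: "0 < r" "r < \<eta>" "K \<inter> sphere a r = {}" using polar_avoids_circle[OF assms] by metis
  have "compact (dist a ` K)" by (intro compact_continuous_image K continuous_intros)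
  then have "open (- dist a ` K)" by (simp add: compact_imp_closed open_Compl)
  moreover have "r \<in> - dist a ` K" using r(3) by auto
  ultimately obtain e where e: "e > 0" "ball r e \<subseteq> - dist a ` K" using open_contains_ball by metis
  define d where "d = min e (min r (\<eta> - r)) / 2"
  have "d \<le> e / 2" "d \<le> r / 2" "d \<le> (\<eta> - r) / 2" unfolding d_def by auto
  moreover have "d > 0" using e r unfolding d_def by auto
  ultimately have d: "d > 0" "d < e" "d < r" "r + d < \<eta>" using e(1) r(1,2) by (auto simp: field_simps)
  have "K \<inter> (cball a (r + d) - ball a (r - d)) = {}"
  proof (intro equals0I)
    fix z assume z: "z \<in> K \<inter> (cball a (r + d) - ball a (r - d))"
    then have "dist a z \<in> ball r e" using d by (auto simp: dist_real_def abs_less_iff)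
    then show False using e(2) z by auto
  qed
  then show ?thesis using d r by (intro exI[of _ "r - d"] exI[of _ "r + d"]) auto
qed

section \<open>Removal of principal parts\<close>

text \<open>Induction on the discs. The first one splits f = G1 + H1, where \<open>G1\<close> is
  singular only on the rest of K, so the induction hypothesis treats Q G1. Splitting Q H1 once more
  leaves a part \<open>H3\<close> bounded off U by \<open>b\<close> times the maximum of |H1| on the
  circle. Therefore \<open>M\<close> depends on f and the discs but not on Q.\<close>

lemma principal_part_cover:
  assumes D: "open D" and U: "U \<subseteq> D"
    and K: "compact K" and f: "f holomorphic_on D - K"
    and L: "\<And>a r s. (a, r, s) \<in> set L \<Longrightarrow> 0 < r \<and> r < s \<and> cball a (2 * s) \<subseteq> U \<and> K \<inter> (cball a s - ball a r) = {}"
    and cover: "K \<subseteq> (\<Union>(a, r, s)\<in>set L. ball a r)"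
  shows "\<exists>M\<ge>0. \<forall>Q b. Q holomorphic_on UNIV \<longrightarrow> 0 \<le> b \<longrightarrow> (\<forall>z\<in>U. cmod (Q z) \<le> b) \<longrightarrow>
     (\<exists>G. G holomorphic_on D \<and> (\<forall>z\<in>D - U. cmod (Q z * f z - G z) \<le> M * b))"
  using K f L cover
proof (induction L arbitrary: K f)
  case Nil
  then have "f holomorphic_on D" by auto
  then have "(\<lambda>z. Q z * f z) holomorphic_on D" if "Q holomorphic_on UNIV" for Q
    using that by (intro holomorphic_intros) (auto intro: holomorphic_on_subset)
  then show ?case by (intro exI[of _ 0]) fastforce
next
  case (Cons t L)
  obtain a r s where t: "t = (a, r, s)" by (cases t)
  have ars: "0 < r" "r < s" "cball a (2 * s) \<subseteq> U" "K \<inter> (cball a s - ball a r) = {}"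
    using Cons.prems(3)[of a r s] t by auto
  have "cball a s \<subseteq> cball a (2 * s)" using ars by auto
  then have sD: "cball a s \<subseteq> D" using ars U by blast
  obtain G1 H1 where G1: "G1 holomorphic_on D - (K - ball a r)" and H1: "H1 holomorphic_on - (K \<inter> ball a r)"
    and split: "\<And>z. z \<in> D - K \<Longrightarrow> f z = G1 z + H1 z"
    using Laurent_splitting[OF D compact_imp_closed[OF Cons.prems(1)] Cons.prems(2) ars(1,2) sD ars(4)] by metis
  have KU: "K \<subseteq> U"
  proof
    fix z assume "z \<in> K"
    then obtain a' r' s' where "(a', r', s') \<in> set (t # L)" "z \<in> ball a' r'" using Cons.prems(4) by blast
    then show "z \<in> U" using Cons.prems(3)[of a' r' s'] by (auto dest!: subsetD[of _ U z])
  qed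
  have "\<exists>M\<ge>0. \<forall>Q b. Q holomorphic_on UNIV \<longrightarrow> 0 \<le> b \<longrightarrow> (\<forall>z\<in>U. cmod (Q z) \<le> b) \<longrightarrow>
     (\<exists>G. G holomorphic_on D \<and> (\<forall>z\<in>D - U. cmod (Q z * G1 z - G z) \<le> M * b))"
  proof (rule Cons.IH[OF _ G1])
    show "compact (K - ball a r)" by (intro compact_diff Cons.prems) auto
    show "0 < r' \<and> r' < s' \<and> cball a' (2 * s') \<subseteq> U \<and> (K - ball a r) \<inter> (cball a' s' - ball a' r') = {}"
      if "(a', r', s') \<in> set L" for a' r' s' using Cons.prems(3)[of a' r' s'] that by auto
    show "K - ball a r \<subseteq> (\<Union>(a, r, s)\<in>set L. ball a r)" using Cons.prems(4) t by auto
  qed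
  then obtain M1 where M1: "M1 \<ge> 0" and IH: "\<And>Q b. Q holomorphic_on UNIV \<Longrightarrow> 0 \<le> b \<Longrightarrow> (\<forall>z\<in>U. cmod (Q z) \<le> b) \<Longrightarrow>
     (\<exists>G. G holomorphic_on D \<and> (\<forall>z\<in>D - U. cmod (Q z * G1 z - G z) \<le> M1 * b))" by blast
  have "continuous_on (sphere a r) H1"
    by (rule continuous_on_subset[OF holomorphic_on_imp_continuous_on[OF H1]]) auto
  then have "compact (H1 ` sphere a r)" by (intro compact_continuous_image) auto
  then obtain b1 where b1: "b1 > 0" "\<And>z. z \<in> sphere a r \<Longrightarrow> cmod (H1 z) \<le> b1"
    using compact_imp_bounded bounded_pos by (metis image_eqI)
  \<comment> \<open>K misses the annulus and in particular the circle of radius r, which makes its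
    part inside the open disc closed.\<close>
  have "K \<inter> ball a r = K \<inter> cball a r" using ars(1,2,4) by force
  then have K1: "closed (K \<inter> ball a r)" using Cons.prems(1) by (auto intro: closed_Int compact_imp_closed)
  show ?case
  proof (intro exI[of _ "M1 + b1"] conjI allI impI)
    show "0 \<le> M1 + b1" using M1 b1 by simp
    fix Q b assume Q: "Q holomorphic_on UNIV" and b: "0 \<le> b" "\<forall>z\<in>U. cmod (Q z) \<le> b"
    obtain G2 where G2: "G2 holomorphic_on D" "\<And>z. z \<in> D - U \<Longrightarrow> cmod (Q z * G1 z - G2 z) \<le> M1 * b"
      using IH[OF Q b] by blast
    have QH: "(\<lambda>z. Q z * H1 z) holomorphic_on UNIV - (K \<inter> ball a r)"
      using H1 by (intro holomorphic_intros holomorphic_on_subset[OF Q]) (auto simp: Compl_eq_Diff_UNIV)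
    have ann: "(K \<inter> ball a r) \<inter> (cball a s - ball a r) = {}" by auto
    \<comment> \<open>Here the domain is the whole plane and all singularities lie in the disc, so
      \<open>G3\<close> is entire and can be added to the holomorphic approximant.\<close>
    obtain G3 H3 where G3: "G3 holomorphic_on UNIV - ((K \<inter> ball a r) - ball a r)"
      and QH3: "\<And>z. z \<in> UNIV - (K \<inter> ball a r) \<Longrightarrow> Q z * H1 z = G3 z + H3 z"
      and H3: "\<And>z B. 2 * r \<le> dist a z \<Longrightarrow> s \<le> dist a z \<Longrightarrow>
        (\<And>\<zeta>. \<zeta> \<in> sphere a r \<Longrightarrow> cmod (Q \<zeta> * H1 \<zeta>) \<le> B) \<Longrightarrow> cmod (H3 z) \<le> B"
      using Laurent_splitting[OF open_UNIV K1 QH ars(1,2) subset_UNIV ann] by metis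
    have "G3 holomorphic_on UNIV" using G3 by (rule holomorphic_on_subset) auto
    then have "(\<lambda>z. G2 z + G3 z) holomorphic_on D"
      using G2 by (intro holomorphic_intros) (auto intro: holomorphic_on_subset)
    moreover have "cmod (Q z * f z - (G2 z + G3 z)) \<le> (M1 + b1) * b" if z: "z \<in> D - U" for z
    proof -
      have zK: "z \<notin> K" using z KU by auto
      have "z \<notin> cball a (2 * s)" using ars(3) z by blast
      then have d: "2 * r \<le> dist a z" "s \<le> dist a z" using ars by auto
      have "cmod (H3 z) \<le> b * b1"
      proof (rule H3[OF d])
        fix \<zeta> assume \<zeta>: "\<zeta> \<in> sphere a r"
        then have "\<zeta> \<in> cball a (2 * s)" using ars by auto
        then have "\<zeta> \<in> U" using ars by blast
        then show "cmod (Q \<zeta> * H1 \<zeta>) \<le> b * b1"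
          unfolding norm_mult using b b1 \<zeta> by (intro mult_mono) auto
      qed
      moreover have "Q z * f z - (G2 z + G3 z) = (Q z * G1 z - G2 z) + H3 z"
        using split[of z] QH3[of z] z zK by (simp add: algebra_simps)
      ultimately have "cmod (Q z * f z - (G2 z + G3 z)) \<le> M1 * b + b * b1"
        using norm_triangle_le add_mono G2(2)[OF z] by metis
      then show ?thesis by (simp add: algebra_simps)
    qed
    ultimately show "\<exists>G. G holomorphic_on D \<and> (\<forall>z\<in>D - U. cmod (Q z * f z - G z) \<le> (M1 + b1) * b)" by blast
  qed
qed

text \<open>By compactness finitely many discs with K-free annuli suffice. The point is the order of
  quantifiers: \<open>M\<close> comes before \<open>Q\<close>, so \<open>Q\<close> may later be
  replaced by high powers.\<close>

lemma principal_part_bound: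
  assumes D: "open D" and U: "open U" "U \<subseteq> D" "K \<subseteq> U"
    and K: "compact K" "polar K" and f: "f holomorphic_on D - K"
  obtains M where "M \<ge> 0" "\<And>Q b. Q holomorphic_on UNIV \<Longrightarrow> 0 \<le> b \<Longrightarrow> (\<And>z. z \<in> U \<Longrightarrow> cmod (Q z) \<le> b) \<Longrightarrow>
     \<exists>G. G holomorphic_on D \<and> (\<forall>z\<in>D - U. cmod (Q z * f z - G z) \<le> M * b)"
proof -
  have "\<exists>r s. 0 < r \<and> r < s \<and> cball a (2 * s) \<subseteq> U \<and> K \<inter> (cball a s - ball a r) = {}" if a: "a \<in> K" for a
  proof -
    obtain e where e: "e > 0" "cball a e \<subseteq> U" using U a open_contains_cball by blast
    obtain r s where rs: "0 < r" "r < s" "s < e/2" "K \<inter> (cball a s - ball a r) = {}"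
      using polar_avoids_annulus[OF K, of "e/2" a] e by auto
    have "cball a (2 * s) \<subseteq> cball a e" using rs by auto
    then show ?thesis using rs e by blast
  qed
  then obtain r s where rs: "\<And>a. a \<in> K \<Longrightarrow> 0 < r a \<and> r a < s a \<and> cball a (2 * s a) \<subseteq> U \<and> K \<inter> (cball a (s a) - ball a (r a)) = {}"
    by metis
  obtain C where C: "C \<subseteq> K" "finite C" "K \<subseteq> (\<Union>a\<in>C. ball a (r a))"
    by (rule compactE_image[OF K(1), of K "\<lambda>a. ball a (r a)"]) (use rs in force)+
  obtain as where as: "set as = C" using finite_list[OF C(2)] by auto
  define L where "L = map (\<lambda>a. (a, r a, s a)) as"
  have "\<exists>M\<ge>0. \<forall>Q b. Q holomorphic_on UNIV \<longrightarrow> 0 \<le> b \<longrightarrow> (\<forall>z\<in>U. cmod (Q z) \<le> b) \<longrightarrow>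
     (\<exists>G. G holomorphic_on D \<and> (\<forall>z\<in>D - U. cmod (Q z * f z - G z) \<le> M * b))"
    by (rule principal_part_cover[OF D U(2) K(1) f, of L]) (use rs C as in \<open>auto simp: L_def\<close>)
  then show thesis using that by blast
qed

section \<open>Approximate equations of the graph\<close>

text \<open>Because all zeros lie in K, every factor is at most |z| + R0 and exceeds \<sigma> at
  points farther than \<sigma> from K. This gives the global upper and the local lower bound besides
  the smallness on K.\<close>

lemma polar_capacity_polynomial:
  assumes K: "compact K" "polar K" and R0: "R0 \<ge> 1" "\<And>z. z \<in> K \<Longrightarrow> cmod z \<le> R0" and \<delta>: "\<delta> > 0"
  obtains n q where "n \<ge> (1::nat)" "q holomorphic_on UNIV" "\<And>z. z \<in> K \<Longrightarrow> cmod (q z) \<le> \<delta> ^ n"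
    "\<And>z. cmod (q z) \<le> (cmod z + R0) ^ n"
    "\<And>z \<sigma>. 0 < \<sigma> \<Longrightarrow> \<sigma> < 1 \<Longrightarrow> (\<And>k. k \<in> K \<Longrightarrow> \<sigma> < dist z k) \<Longrightarrow> \<sigma> ^ n < cmod (q z)"
proof (cases "K = {}")
  case True
  \<comment> \<open>For empty K the constant 1 with n = 1 satisfies all bounds.\<close>
  show thesis
  proof (rule that[of 1 "\<lambda>_. 1"])
    show "cmod 1 \<le> (cmod z + R0) ^ 1" for z :: complex
      using R0(1) norm_ge_zero[of z] by (simp del: norm_ge_zero)
  qed (use True in auto)
next
  case False
  obtain n \<zeta> where n: "n \<ge> 1" and \<zeta>: "\<And>i. i < n \<Longrightarrow> \<zeta> i \<in> K" and q: "\<And>z. z \<in> K \<Longrightarrow> (\<Prod>i<n. cmod (z - \<zeta> i)) \<le> \<delta> ^ n"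
    using polar_imp_small_polynomial[OF K(1) False K(2) \<delta>] by auto
  show thesis
  proof (rule that[of n "\<lambda>z. \<Prod>i<n. z - \<zeta> i"])
    show "(\<lambda>z. \<Prod>i<n. z - \<zeta> i) holomorphic_on UNIV" by (intro holomorphic_intros)
    show "cmod (\<Prod>i<n. z - \<zeta> i) \<le> \<delta> ^ n" if "z \<in> K" for z using q[OF that] by (simp add: prod_norm)
    show "cmod (\<Prod>i<n. z - \<zeta> i) \<le> (cmod z + R0) ^ n" for z
    proof -
      have "(\<Prod>i<n. cmod (z - \<zeta> i)) \<le> (\<Prod>i<n. cmod z + R0)"
      proof (intro prod_mono conjI)
        fix i assume "i \<in> {..<n}"
        then have "cmod (\<zeta> i) \<le> R0" using \<zeta> R0 by auto
        then show "cmod (z - \<zeta> i) \<le> cmod z + R0" using norm_triangle_ineq4[of z "\<zeta> i"] by linarith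
      qed auto
      then show ?thesis by (simp add: prod_norm)
    qed
    fix z \<sigma> assume \<sigma>: "0 < \<sigma>" "\<sigma> < 1" "\<And>k. k \<in> K \<Longrightarrow> \<sigma> < dist z k"
    have "(\<Prod>i<n. \<sigma>) < (\<Prod>i<n. cmod (z - \<zeta> i))"
      using n \<sigma> \<zeta> by (intro prod_mono_strict[of 0]) (force simp: dist_norm intro: less_imp_le)+
    then show "\<sigma> ^ n < cmod (\<Prod>i<n. z - \<zeta> i)" by (simp add: prod_norm)
  qed (use n in auto)
qed

text \<open>Here Q = q^m for a small polynomial \<open>q\<close>, and \<open>G\<close> is Q f with
  its principal part removed. The zero set of Q w - G imitates the graph together with K times the
  plane. All constants that arise are absorbed into 2^N by a large \<open>m\<close>.\<close>

lemma approximation_step: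
  assumes D: "open D" and K: "compact K" "polar K" "K \<subseteq> D" and f: "f holomorphic_on D - K"
    and R0: "R0 \<ge> 1" "\<And>z. z \<in> K \<Longrightarrow> cmod z \<le> R0"
    and X: "compact X" "X \<subseteq> D" and L: "L \<ge> 0"
    and \<epsilon>: "0 < \<epsilon>" "\<epsilon> < 1" "\<And>k. k \<in> K \<Longrightarrow> cball k \<epsilon> \<subseteq> D"
  obtains N Q G where "N \<ge> (1::nat)" "Q holomorphic_on UNIV" "G holomorphic_on D"
    "\<And>z w. z \<in> X \<Longrightarrow> cmod w \<le> L \<Longrightarrow> cmod (Q z * w - G z) \<le> (2 * (cmod z + R0)) ^ N"
    "\<And>z. z \<in> D \<Longrightarrow> (\<And>k. k \<in> K \<Longrightarrow> \<epsilon> < dist z k) \<Longrightarrow> cmod (Q z * f z - G z) \<le> (2 * \<epsilon>) ^ N"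
    "\<And>z w. z \<in> K \<Longrightarrow> cmod w \<le> L \<Longrightarrow> cmod (Q z * w - G z) \<le> (2 * \<epsilon>) ^ N"
    "\<And>z \<sigma>. 0 < \<sigma> \<Longrightarrow> \<sigma> < 1 \<Longrightarrow> (\<And>k. k \<in> K \<Longrightarrow> \<sigma> < dist z k) \<Longrightarrow> \<sigma> ^ N \<le> cmod (Q z)"
proof -
  obtain n q where n: "n \<ge> 1" and q: "q holomorphic_on UNIV" and qK: "\<And>z. z \<in> K \<Longrightarrow> cmod (q z) \<le> (\<epsilon>/2) ^ n"
    and qub: "\<And>z. cmod (q z) \<le> (cmod z + R0) ^ n"
    and qlb: "\<And>z \<sigma>. 0 < \<sigma> \<Longrightarrow> \<sigma> < 1 \<Longrightarrow> (\<And>k. k \<in> K \<Longrightarrow> \<sigma> < dist z k) \<Longrightarrow> \<sigma> ^ n < cmod (q z)"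
    using polar_capacity_polynomial[OF K(1,2) R0, of "\<epsilon>/2"] \<epsilon> by (metis half_gt_zero)
  have qc: "continuous_on UNIV q" using q by (rule holomorphic_on_imp_continuous_on)
  \<comment> \<open>On K, |q| is at most (\<epsilon>/2)^n, so K lies inside U. The lower bound for
    |q| keeps the sublevel set \<open>V\<close> within distance \<epsilon> of K, hence inside
    D.\<close>
  define U where "U = {z. cmod (q z) < \<epsilon> ^ n}"
  define V where "V = {z. cmod (q z) \<le> \<epsilon> ^ n}"
  have U: "open U" unfolding U_def by (intro open_Collect_less continuous_intros qc)
  have V: "closed V" unfolding V_def by (intro closed_Collect_le continuous_intros qc)
  have "closure U \<subseteq> V" using V by (intro closure_minimal) (auto simp: U_def V_def)
  have Vnear: "\<exists>k\<in>K. dist z k \<le> \<epsilon>" if "z \<in> V" for z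
    using qlb[OF \<epsilon>(1,2), of z] that unfolding V_def by force
  have VD: "V \<subseteq> D"
  proof
    fix z assume "z \<in> V"
    then obtain k where "k \<in> K" "dist z k \<le> \<epsilon>" using Vnear by blast
    then show "z \<in> D" using \<epsilon>(3)[of k] by (auto simp: dist_commute)
  qed
  have "bounded V"
  proof (rule boundedI[of _ "R0 + 1"])
    fix z assume "z \<in> V"
    then obtain k where k: "k \<in> K" "dist z k \<le> \<epsilon>" using Vnear by blast
    then show "cmod z \<le> R0 + 1"
      using R0(2)[of k] \<epsilon>(2) norm_triangle_ineq2[of z k] by (simp add: dist_norm)
  qed
  have UV: "U \<subseteq> V" unfolding U_def V_def by auto
  have bU: "bounded U" using \<open>bounded V\<close> UV bounded_subset by blast
  have "(\<epsilon>/2) ^ n < \<epsilon> ^ n" using \<epsilon> n by (intro power_strict_mono) auto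
  then have KU: "K \<subseteq> U" using qK unfolding U_def by force
  obtain M where M: "M \<ge> 0" "\<And>Q b. Q holomorphic_on UNIV \<Longrightarrow> 0 \<le> b \<Longrightarrow> (\<And>z. z \<in> U \<Longrightarrow> cmod (Q z) \<le> b) \<Longrightarrow>
     \<exists>G. G holomorphic_on D \<and> (\<forall>z\<in>D - U. cmod (Q z * f z - G z) \<le> M * b)"
    using principal_part_bound[OF D U _ KU K(1,2) f] UV VD by blast
  have fr: "frontier U \<subseteq> V - U"
    using \<open>closure U \<subseteq> V\<close> U by (auto simp: frontier_def interior_open)
  have "compact ((X - U) \<union> frontier U)"
    using X U bU by (intro compact_Un compact_diff compact_frontier_bounded) auto
  moreover have "(X - U) \<union> frontier U \<subseteq> D - K" using X(2) KU fr VD by auto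
  ultimately have "compact (f ` ((X - U) \<union> frontier U))"
    by (intro compact_continuous_image) (auto intro: continuous_on_subset[OF holomorphic_on_imp_continuous_on[OF f]])
  then obtain M2 where M2: "M2 > 0" "\<And>z. z \<in> (X - U) \<union> frontier U \<Longrightarrow> cmod (f z) \<le> M2"
    using compact_imp_bounded bounded_pos by (metis image_eqI)
  \<comment> \<open>\<open>M\<close> and \<open>M2\<close> depend on \<open>q\<close> and
    \<open>U\<close> but not on the exponent, so the exponent can be fixed after them.\<close>
  obtain m0 where m0: "L + M + M2 < 2 ^ m0" using real_arch_pow[of 2 "L + M + M2"] by auto
  define m where "m = Suc m0"
  have m: "L + M + M2 \<le> 2 ^ m" "m \<ge> 1" using m0 zero_le_power[of "2::real" m0] unfolding m_def power_Suc by linarith+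
  define N where "N = n * m"
  have N: "N \<ge> 1" "m \<le> N" using n m(2) unfolding N_def by auto
  have "(2::real) ^ m \<le> 2 ^ N" using N by (intro power_increasing) auto
  then have LN: "L + M + M2 \<le> 2 ^ N" using m by linarith
  define Q where "Q = (\<lambda>z. q z ^ m)"
  have Q: "Q holomorphic_on UNIV" unfolding Q_def by (intro holomorphic_intros q)
  have nQ: "cmod (Q z) = cmod (q z) ^ m" for z by (simp add: Q_def norm_power)
  have QV: "cmod (Q z) \<le> \<epsilon> ^ N" if "z \<in> V" for z
    unfolding nQ N_def power_mult using that by (intro power_mono) (auto simp: V_def)
  have Qub: "cmod (Q z) \<le> (cmod z + R0) ^ N" for z
    unfolding nQ N_def power_mult using qub by (intro power_mono) auto
  have e0: "0 \<le> \<epsilon> ^ N" using \<epsilon> by simp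
  obtain G where G: "G holomorphic_on D" "\<And>z. z \<in> D - U \<Longrightarrow> cmod (Q z * f z - G z) \<le> M * \<epsilon> ^ N"
    using M(2)[OF Q e0] QV UV by blast
  \<comment> \<open>Q f may be singular in U, but \<open>G\<close> is not. Its bound on the
    frontier, where it is close to Q f, spreads over U by the maximum modulus principle.\<close>
  have GU: "cmod (G z) \<le> (M + M2) * \<epsilon> ^ N" if "z \<in> U" for z
  proof (rule maximum_modulus_frontier[of G U])
    show "G holomorphic_on interior U" using G(1) UV VD U by (auto simp: interior_open intro: holomorphic_on_subset)
    show "continuous_on (closure U) G"
      using \<open>closure U \<subseteq> V\<close> VD by (intro continuous_on_subset[OF holomorphic_on_imp_continuous_on[OF G(1)]]) auto
    fix x assume x: "x \<in> frontier U"
    then have xV: "x \<in> V - U" "x \<in> D - U" using fr VD by auto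
    have "cmod (G x) \<le> cmod (Q x * f x) + cmod (Q x * f x - G x)"
      using norm_triangle_sub[of "G x" "Q x * f x"] by (simp add: norm_minus_commute)
    also have "\<dots> \<le> \<epsilon> ^ N * M2 + M * \<epsilon> ^ N"
      unfolding norm_mult using QV[of x] M2(2)[of x] x xV G(2)[of x] e0 by (intro add_mono mult_mono) auto
    finally show "cmod (G x) \<le> (M + M2) * \<epsilon> ^ N" by (simp add: algebra_simps)
  qed (use bU that in auto)
  have inU: "cmod (Q z * w - G z) \<le> (2 * \<epsilon>) ^ N" if z: "z \<in> U" and w: "cmod w \<le> L" for z w
  proof -
    have "cmod (Q z * w - G z) \<le> cmod (Q z) * cmod w + cmod (G z)"
      using norm_triangle_ineq4[of "Q z * w" "G z"] by (simp add: norm_mult)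
    also have "\<dots> \<le> \<epsilon> ^ N * L + (M + M2) * \<epsilon> ^ N"
      using QV[of z] UV z w GU[OF z] e0 by (intro add_mono mult_mono) auto
    also have "\<dots> = (L + M + M2) * \<epsilon> ^ N" by (simp add: algebra_simps)
    also have "\<dots> \<le> 2 ^ N * \<epsilon> ^ N" using LN e0 by (intro mult_right_mono) auto
    finally show ?thesis by (simp add: power_mult_distrib)
  qed
  show thesis
  proof (rule that[OF N(1) Q G(1)])
    fix z w assume z: "z \<in> X" and w: "cmod w \<le> L"
    have R: "\<epsilon> \<le> cmod z + R0" using \<epsilon>(2) R0(1) norm_ge_zero[of z] by linarith
    show "cmod (Q z * w - G z) \<le> (2 * (cmod z + R0)) ^ N"
    proof (cases "z \<in> U")
      case True
      have "(2 * \<epsilon>) ^ N \<le> (2 * (cmod z + R0)) ^ N" using R \<epsilon> by (intro power_mono) auto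
      then show ?thesis using inU[OF True w] by linarith
    next
      case False
      then have z': "z \<in> D - U" "z \<in> (X - U) \<union> frontier U" using z X by auto
      have "Q z * w - G z = Q z * (w - f z) + (Q z * f z - G z)" by (simp add: algebra_simps)
      then have "cmod (Q z * w - G z) \<le> cmod (Q z) * cmod (w - f z) + cmod (Q z * f z - G z)"
        by (metis norm_mult norm_triangle_ineq)
      also have "\<dots> \<le> (cmod z + R0) ^ N * (L + M2) + M * (cmod z + R0) ^ N"
      proof (intro add_mono mult_mono Qub)
        show "cmod (w - f z) \<le> L + M2"
          using norm_triangle_ineq4[of w "f z"] w M2(2)[OF z'(2)] by linarith
        have "\<epsilon> ^ N \<le> (cmod z + R0) ^ N" using R \<epsilon> by (intro power_mono) auto
        then have "M * \<epsilon> ^ N \<le> M * (cmod z + R0) ^ N" using M(1) by (intro mult_left_mono)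
        then show "cmod (Q z * f z - G z) \<le> M * (cmod z + R0) ^ N" using G(2)[OF z'(1)] by linarith
      qed (use R \<epsilon> in auto)
      also have "\<dots> = (L + M + M2) * (cmod z + R0) ^ N" by (simp add: algebra_simps)
      also have "\<dots> \<le> 2 ^ N * (cmod z + R0) ^ N" using LN R \<epsilon> by (intro mult_right_mono) auto
      finally show ?thesis by (simp only: power_mult_distrib)
    qed
  next
    fix z assume z: "z \<in> D" "\<And>k. k \<in> K \<Longrightarrow> \<epsilon> < dist z k"
    have "z \<in> D - U" using z qlb[OF \<epsilon>(1,2), of z] unfolding U_def by force
    then have "cmod (Q z * f z - G z) \<le> M * \<epsilon> ^ N" by (rule G(2))
    also have "\<dots> \<le> 2 ^ N * \<epsilon> ^ N" using LN M2(1) L e0 by (intro mult_right_mono) auto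
    finally show "cmod (Q z * f z - G z) \<le> (2 * \<epsilon>) ^ N" by (simp add: power_mult_distrib)
  next
    fix z w assume "z \<in> K" "cmod w \<le> L"
    then show "cmod (Q z * w - G z) \<le> (2 * \<epsilon>) ^ N" using inU KU by blast
  next
    fix z and \<sigma> :: real assume \<sigma>: "0 < \<sigma>" "\<sigma> < 1" "\<And>k. k \<in> K \<Longrightarrow> \<sigma> < dist z k"
    show "\<sigma> ^ N \<le> cmod (Q z)"
      unfolding nQ N_def power_mult using qlb[OF \<sigma>] \<sigma>(1) by (intro power_mono) auto
  qed
qed

subsection \<open>Plurisubharmonic functions from logarithms of holomorphic functions\<close>

lemma eexp_minus_infinity [simp]: "eexp (-\<infinity>) = 0"
  using eexp.simps(2) by (simp only: MInfty_eq_minfinity)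

text \<open>\<open>eexp\<close> returns 0 at plus infinity and preserves order only below it, hence
  the finiteness assumption.\<close>

lemma usc_on_eexp:
  assumes c: "continuous_on S (\<lambda>p. eexp (u p))" and fin: "\<And>z. z \<in> S \<Longrightarrow> u z < \<infinity>"
  shows "usc_on S u"
  unfolding usc_on_def
proof
  fix c :: ereal
  show "openin (top_of_set S) {z \<in> S. u z < c}"
  proof (cases c)
    case (real x)
    have "u z < c \<longleftrightarrow> eexp (u z) < exp x" if "z \<in> S" for z
      using fin[OF that] real by (cases "u z") auto
    then have "{z \<in> S. u z < c} = S \<inter> (\<lambda>p. eexp (u p)) -` {..<exp x}" by auto
    then show ?thesis using continuous_openin_preimage_gen[OF c, of "{..<exp x}"] by simp
  next
    case PInf
    then have "{z \<in> S. u z < c} = S" using fin by auto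
    then show ?thesis by simp
  next
    case MInf
    then have "{z \<in> S. u z < c} = {}" by auto
    then show ?thesis by (simp only: openin_empty)
  qed
qed

text \<open>Either the truncation is active at the centre and the constant ln c is a minorant with
  the same central value, or ln |g| is a harmonic one. The alternative \<open>nz\<close> spares a
  discussion of the zeros of g.\<close>

lemma ln_max_norm_submean:
  assumes g: "g holomorphic_on ball a \<rho>" and r: "0 < r" "r < \<rho>" and c: "c > 0"
    and nz: "cmod (g a) \<le> c \<or> (\<forall>z\<in>ball a \<rho>. g z \<noteq> 0)"
  shows "2 * pi * ln (max (cmod (g a)) c) \<le> integral {0..2*pi} (\<lambda>t. ln (max (cmod (g (a + of_real r * cis t))) c))"
proof -
  have circ: "a + of_real r * cis t \<in> ball a \<rho>" for t using r by (simp add: dist_norm norm_mult)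
  have "continuous_on {0..2*pi} (\<lambda>t. g (a + of_real r * cis t))"
    by (rule continuous_on_compose2[OF holomorphic_on_imp_continuous_on[OF g]])
       (use circ in \<open>auto intro!: continuous_intros\<close>)
  then have "continuous_on {0..2*pi} (\<lambda>t. ln (max (cmod (g (a + of_real r * cis t))) c))"
    using c by (intro continuous_intros) auto
  then have int: "(\<lambda>t. ln (max (cmod (g (a + of_real r * cis t))) c)) integrable_on {0..2*pi}"
    by (rule integrable_continuous_interval)
  show ?thesis
  proof (cases "cmod (g a) \<le> c")
    case True
    have "integral {0..2*pi} (\<lambda>t. ln c) \<le> integral {0..2*pi} (\<lambda>t. ln (max (cmod (g (a + of_real r * cis t))) c))"
      by (rule integral_le[OF _ int]) (use c in auto)
    then show ?thesis using True by (simp add: max_def)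
  next
    case False
    then have nz': "\<And>z. z \<in> ball a \<rho> \<Longrightarrow> g z \<noteq> 0" using nz by blast
    note mv = ln_norm_holomorphic_mean_value[OF g nz' r]
    have "integral {0..2*pi} (\<lambda>t. ln (cmod (g (a + of_real r * cis t)))) \<le>
        integral {0..2*pi} (\<lambda>t. ln (max (cmod (g (a + of_real r * cis t))) c))"
      using mv nz'[OF circ] by (intro integral_le int) (auto simp: has_integral_integrable intro!: ln_mono)
    then show ?thesis using False integral_unique[OF mv] by (simp add: max_def)
  qed
qed

text \<open>\<open>u\<close> is the sum of the terms ln |g j| truncated at -\<mu> j and divided by
  \<mu> j. On E they are eventually -1 and the sum diverges; off E they eventually lie between
  -(1/2)^j and 0, locally uniformly, and the sum converges. Locally almost all terms are
  nonpositive, so the partial sums eventually decrease.\<close>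

lemma continuous_psh_from_logarithms:
  fixes g :: "nat \<Rightarrow> complex \<times> complex \<Rightarrow> complex" and \<mu> :: "nat \<Rightarrow> real"
  assumes \<Omega>: "open \<Omega>" and E: "E \<subseteq> \<Omega>" and \<mu>: "\<And>j. \<mu> j > 0"
    and cont: "\<And>j. continuous_on \<Omega> (g j)"
    and hol: "\<And>j a b. (\<lambda>\<zeta>. g j (fst a + \<zeta> * fst b, snd a + \<zeta> * snd b)) holomorphic_on
                {\<zeta>. (fst a + \<zeta> * fst b, snd a + \<zeta> * snd b) \<in> \<Omega>}"
    and upper: "\<And>p. p \<in> \<Omega> \<Longrightarrow> \<exists>T. open T \<and> p \<in> T \<and> (\<forall>\<^sub>F j in sequentially. \<forall>q\<in>T \<inter> \<Omega>. cmod (g j q) \<le> 1)"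
    and on: "\<And>p. p \<in> E \<Longrightarrow> \<forall>\<^sub>F j in sequentially. cmod (g j p) \<le> exp (- \<mu> j)"
    and off: "\<And>p. p \<in> \<Omega> - E \<Longrightarrow> \<exists>T. open T \<and> p \<in> T \<and>
                (\<forall>\<^sub>F j in sequentially. \<forall>q\<in>T \<inter> \<Omega>. exp (- \<mu> j / 2 ^ j) \<le> cmod (g j q))"
  shows "\<exists>u. continuous_psh_on \<Omega> u \<and> {p \<in> \<Omega>. u p = -\<infinity>} = E"
proof -
  define \<omega> where "\<omega> = (\<lambda>j p. ln (max (cmod (g j p)) (exp (- \<mu> j))) / \<mu> j)"
  define v where "v = (\<lambda>p. \<Sum>j. \<omega> j p)"
  define S where "S = (\<lambda>n p. \<Sum>j<n. \<omega> j p)"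
  \<comment> \<open>On E the series diverges and \<open>suminf\<close> has no meaning, so the value
    is set explicitly.\<close>
  define u where "u = (\<lambda>p. if p \<in> E then -\<infinity> else ereal (v p))"
  have \<omega>c: "continuous_on \<Omega> (\<omega> j)" for j
    unfolding \<omega>_def using \<mu>[of j] by (intro continuous_intros cont) (auto simp: max_def)
  have Sc: "continuous_on \<Omega> (S n)" for n unfolding S_def by (intro continuous_intros \<omega>c)
  have \<omega>le: "\<omega> j p \<le> 0" if "cmod (g j p) \<le> 1" for j p
    unfolding \<omega>_def using \<mu>[of j] that
    by (intro divide_nonpos_pos ln_le_zero_iff[THEN iffD2]) (auto simp: less_max_iff_disj)
  have \<omega>E: "\<omega> j p = -1" if "cmod (g j p) \<le> exp (- \<mu> j)" for j p
    unfolding \<omega>_def using \<mu>[of j] that by (simp add: max_def)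

  have local: "\<exists>T J. open T \<and> p \<in> T \<and> T \<subseteq> \<Omega> - E \<and>
      (\<forall>j\<ge>J. \<forall>q\<in>T. g j q \<noteq> 0 \<and> \<omega> j q \<le> 0 \<and> - ((1/2) ^ j) \<le> \<omega> j q)" if p: "p \<in> \<Omega> - E" for p
  proof -
    obtain T1 where T1: "open T1" "p \<in> T1" "\<forall>\<^sub>F j in sequentially. \<forall>q\<in>T1 \<inter> \<Omega>. cmod (g j q) \<le> 1"
      using upper[of p] p by auto
    obtain T2 where T2: "open T2" "p \<in> T2" "\<forall>\<^sub>F j in sequentially. \<forall>q\<in>T2 \<inter> \<Omega>. exp (- \<mu> j / 2 ^ j) \<le> cmod (g j q)"
      using off[of p] p by auto
    obtain J where J: "\<And>j q. j \<ge> J \<Longrightarrow> q \<in> T1 \<inter> \<Omega> \<Longrightarrow> cmod (g j q) \<le> 1"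
        "\<And>j q. j \<ge> J \<Longrightarrow> q \<in> T2 \<inter> \<Omega> \<Longrightarrow> exp (- \<mu> j / 2 ^ j) \<le> cmod (g j q)"
      using eventually_conj[OF T1(3) T2(3)] unfolding eventually_sequentially by blast
    define T where "T = T1 \<inter> T2 \<inter> \<Omega>"
    have "q \<notin> E" if q: "q \<in> T" for q
    proof
      assume "q \<in> E"
      then obtain J' where J': "\<And>j. j \<ge> J' \<Longrightarrow> cmod (g j q) \<le> exp (- \<mu> j)"
        using on unfolding eventually_sequentially by blast
      \<comment> \<open>\<open>Suc\<close> makes 2^j > 1, so that the two bounds for |g j q| exclude
        each other.\<close>
      define j where "j = Suc (max J J')"
      have "exp (- \<mu> j / 2 ^ j) \<le> exp (- \<mu> j)"
      proof (rule order_trans)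
        show "exp (- \<mu> j / 2 ^ j) \<le> cmod (g j q)" using J(2)[of j q] q unfolding T_def j_def by auto
        show "cmod (g j q) \<le> exp (- \<mu> j)" using J'[of j] unfolding j_def by auto
      qed
      then have "\<mu> j \<le> \<mu> j / 2 ^ j" by simp
      moreover have "(2::real) ^ j > 1" unfolding j_def by (rule one_less_power) auto
      then have "\<mu> j / 2 ^ j < \<mu> j" using \<mu>[of j] by (simp add: field_simps)
      ultimately show False by linarith
    qed
    moreover have "g j q \<noteq> 0 \<and> \<omega> j q \<le> 0 \<and> - ((1/2) ^ j) \<le> \<omega> j q" if j: "j \<ge> J" and q: "q \<in> T" for j q
    proof -
      have lo: "exp (- \<mu> j / 2 ^ j) \<le> cmod (g j q)" using J(2) j q unfolding T_def by auto
      then have nz: "g j q \<noteq> 0" using exp_gt_zero[of "- \<mu> j / 2 ^ j"] by (auto simp del: exp_gt_zero)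
      have "- \<mu> j / 2 ^ j = ln (exp (- \<mu> j / 2 ^ j))" by simp
      also have "\<dots> \<le> ln (max (cmod (g j q)) (exp (- \<mu> j)))"
        using lo by (intro ln_mono) auto
      finally have "- \<mu> j / 2 ^ j / \<mu> j \<le> \<omega> j q"
        unfolding \<omega>_def using \<mu>[of j] by (intro divide_right_mono) auto
      then show ?thesis using nz \<omega>le[of j q] J(1)[of j q] j q \<mu>[of j] unfolding T_def by (simp add: power_divide)
    qed
    ultimately show ?thesis using T1 T2 p \<Omega> by (intro exI[of _ T] exI[of _ J]) (auto simp: T_def)
  qed

  have tail: "summable (\<lambda>j. \<omega> j q) \<and> v q \<le> S n q \<and> S n q \<le> v q + 2 * (1/2) ^ n"
    if J: "\<And>j. j \<ge> J \<Longrightarrow> \<omega> j q \<le> 0 \<and> - ((1/2) ^ j) \<le> \<omega> j q" and n: "n \<ge> J" for J n q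
  proof -
    have sm: "summable (\<lambda>j. \<omega> j q)"
      by (rule summable_comparison_test'[of "\<lambda>j. (1/2) ^ j" J])
         (use J in \<open>auto simp: summable_geometric abs_le_iff minus_le_iff intro: order_trans\<close>)
    have gs: "summable (\<lambda>i. - ((1/2::real) ^ (i + n)))"
      by (intro summable_minus summable_ignore_initial_segment summable_geometric) auto
    have sp: "v q = (\<Sum>i. \<omega> (i + n) q) + S n q"
      unfolding v_def S_def by (rule suminf_split_initial_segment[OF sm])
    have st: "summable (\<lambda>i. \<omega> (i + n) q)" using sm by (rule summable_ignore_initial_segment)
    have "(\<Sum>i. \<omega> (i + n) q) \<le> (\<Sum>i. 0)" using J n by (intro suminf_le st) auto
    moreover have "(\<Sum>i. - ((1/2::real) ^ (i + n))) \<le> (\<Sum>i. \<omega> (i + n) q)" using J n by (intro suminf_le st gs) auto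
    moreover have "(\<Sum>i. - ((1/2::real) ^ (i + n))) = - (2 * (1/2) ^ n)"
    proof -
      have "(\<lambda>i. - ((1/2::real) ^ n) * (1/2) ^ i) sums (- ((1/2::real) ^ n) * (1 / (1 - 1/2)))"
        by (intro sums_mult geometric_sums) auto
      then show ?thesis by (simp add: power_add mult.commute sums_iff)
    qed
    ultimately show ?thesis using sm sp by simp
  qed

  have vc: "continuous_on T v" if T: "T \<subseteq> \<Omega>" and J: "\<And>j q. j \<ge> J \<Longrightarrow> q \<in> T \<Longrightarrow> \<omega> j q \<le> 0 \<and> - ((1/2) ^ j) \<le> \<omega> j q" for T J
  proof -
    have "uniform_limit T (\<lambda>n q. \<Sum>i<n. \<omega> i q) (\<lambda>q. \<Sum>j. \<omega> j q) sequentially"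
    proof (rule Weierstrass_m_test_ev[where M = "\<lambda>j. (1/2) ^ j"])
      show "\<forall>\<^sub>F j in sequentially. \<forall>q\<in>T. norm (\<omega> j q) \<le> (1/2) ^ j"
        unfolding eventually_sequentially by (intro exI[of _ J]) (use J in force)
    qed (auto simp: summable_geometric)
    then show ?thesis
      unfolding v_def using Sc[unfolded S_def] T
      by (intro uniform_limit_theorem[rotated]) (auto intro: continuous_on_subset always_eventually)
  qed

  \<comment> \<open>At p the partial sums fall by 1 at each step from J on. One that lies below c at
    p does so nearby, and the later terms only lower the sum.\<close>
  have small: "\<exists>T. open T \<and> p \<in> T \<and> (\<forall>q\<in>T \<inter> \<Omega> - E. v q < c)" if p: "p \<in> E" for p c
  proof -
    obtain T1 where T1: "open T1" "p \<in> T1" "\<forall>\<^sub>F j in sequentially. \<forall>q\<in>T1 \<inter> \<Omega>. cmod (g j q) \<le> 1"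
      using upper[of p] p E by blast
    obtain J where J: "\<And>j q. j \<ge> J \<Longrightarrow> q \<in> T1 \<inter> \<Omega> \<Longrightarrow> cmod (g j q) \<le> 1"
        "\<And>j. j \<ge> J \<Longrightarrow> cmod (g j p) \<le> exp (- \<mu> j)"
      using eventually_conj[OF T1(3) on[OF p]] unfolding eventually_sequentially by blast
    have Sp: "S (J + m) p = S J p - m" for m
      by (induction m) (auto simp: S_def \<omega>E[OF J(2)])
    obtain m :: nat where "m > S J p - c" using reals_Archimedean2 by blast
    define n where "n = J + m"
    have "S n p < c" using Sp[of m] \<open>m > S J p - c\<close> unfolding n_def by simp
    have "open (\<Omega> \<inter> S n -` {..<c})" using continuous_open_preimage[OF Sc \<Omega>, of "{..<c}"] by simp
    moreover have "v q < c" if q: "q \<in> T1 \<inter> (\<Omega> \<inter> S n -` {..<c}) - E" for q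
    proof -
      obtain T J2 where TJ: "q \<in> T" "\<forall>j\<ge>J2. \<forall>q\<in>T. g j q \<noteq> 0 \<and> \<omega> j q \<le> 0 \<and> - ((1/2) ^ j) \<le> \<omega> j q"
        using local[of q] q by blast
      define N where "N = max n J2"
      have "v q \<le> S N q" using tail[of J2 q N] TJ unfolding N_def by auto
      also have "S N q = S n q + (\<Sum>j\<in>{n..<N}. \<omega> j q)"
        unfolding S_def N_def by (simp add: lessThan_atLeast0 sum.atLeastLessThan_concat)
      also have "\<dots> \<le> S n q + 0"
        using q by (intro add_left_mono sum_nonpos \<omega>le J(1)) (auto simp: n_def)
      also have "\<dots> < c" using q by auto
      finally show ?thesis .
    qed
    ultimately show ?thesis using T1 p E \<open>S n p < c\<close>
      by (intro exI[of _ "T1 \<inter> (\<Omega> \<inter> S n -` {..<c})"]) auto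
  qed

  have ufin: "u p < \<infinity>" for p unfolding u_def by auto

  have ec: "continuous_on \<Omega> (\<lambda>p. eexp (u p))"
    unfolding continuous_on_eq_continuous_at[OF \<Omega>]
  proof
    fix p assume p: "p \<in> \<Omega>"
    show "isCont (\<lambda>p. eexp (u p)) p"
    proof (cases "p \<in> E")
      case False
      obtain T J where TJ: "open T" "p \<in> T" "T \<subseteq> \<Omega> - E"
         "\<forall>j\<ge>J. \<forall>q\<in>T. g j q \<noteq> 0 \<and> \<omega> j q \<le> 0 \<and> - ((1/2) ^ j) \<le> \<omega> j q"
        using local[of p] False p by blast
      have "continuous_on T v" by (rule vc[of T J]) (use TJ in auto)
      then have "continuous_on T (\<lambda>q. exp (v q))" by (intro continuous_intros)
      then have "continuous_on T (\<lambda>q. eexp (u q))"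
        by (rule continuous_on_eq) (use TJ(3) in \<open>auto simp: u_def\<close>)
      then show ?thesis using TJ by (simp add: continuous_on_eq_continuous_at)
    next
      case True
      have "((\<lambda>q. eexp (u q)) \<longlongrightarrow> 0) (at p)"
      proof (rule tendstoI)
        fix e :: real assume e: "e > 0"
        obtain T where T: "open T" "p \<in> T" "\<forall>q\<in>T \<inter> \<Omega> - E. v q < ln e" using small[OF True] by blast
        have "dist (eexp (u q)) 0 < e" if "q \<in> T \<inter> \<Omega>" for q
        proof (cases "q \<in> E")
          case False
          then have "exp (v q) < exp (ln e)" using T that by simp
          then show ?thesis using False e by (simp add: u_def)
        qed (use e in \<open>simp add: u_def\<close>)
        then show "\<forall>\<^sub>F q in at p. dist (eexp (u q)) 0 < e"
          unfolding eventually_at_topological using T \<Omega> p by (intro exI[of _ "T \<inter> \<Omega>"]) auto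
      qed
      then show ?thesis using True by (simp add: isCont_def u_def)
    qed
  qed

  have slice: "subharmonic_on {\<zeta>. (fst a + \<zeta> * fst b, snd a + \<zeta> * snd b) \<in> \<Omega>}
       (\<lambda>\<zeta>. u (fst a + \<zeta> * fst b, snd a + \<zeta> * snd b))" for a b :: "complex \<times> complex"
  proof -
    define l where "l = (\<lambda>\<zeta>. (fst a + \<zeta> * fst b, snd a + \<zeta> * snd b))"
    have lc: "continuous_on A l" for A unfolding l_def by (intro continuous_intros)
    define \<Sigma> where "\<Sigma> = {\<zeta>. l \<zeta> \<in> \<Omega>}"
    have ol: "open {\<zeta>. l \<zeta> \<in> T}" if "open T" for T
      using open_vimage[OF that lc[of UNIV]] by (simp add: vimage_def)
    have \<Sigma>: "open \<Sigma>" unfolding \<Sigma>_def by (rule ol[OF \<Omega>])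
    have lec: "continuous_on \<Sigma> (\<lambda>\<zeta>. eexp (u (l \<zeta>)))"
      by (rule continuous_on_compose2[OF ec lc]) (auto simp: \<Sigma>_def)
    have glh: "(\<lambda>\<zeta>. g j (l \<zeta>)) holomorphic_on \<Sigma>" for j
      using hol[of j a b] unfolding l_def \<Sigma>_def .
    have "\<exists>\<rho>>0. cball c \<rho> \<subseteq> \<Sigma> \<and> (\<forall>r. 0 < r \<and> r < \<rho> \<longrightarrow> submean_at (\<lambda>\<zeta>. u (l \<zeta>)) c r)"
      if c: "c \<in> \<Sigma>" for c
    proof (cases "l c \<in> E")
      case True
      then have "u (l c) = -\<infinity>" by (simp add: u_def)
      then have "submean_at (\<lambda>\<zeta>. u (l \<zeta>)) c r" for r unfolding submean_at_def by simp
      then show ?thesis using c \<Sigma> open_contains_cball by blast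
    next
      case False
      obtain T J where TJ: "open T" "l c \<in> T" "T \<subseteq> \<Omega> - E"
         "\<And>j q. j \<ge> J \<Longrightarrow> q \<in> T \<Longrightarrow> g j q \<noteq> 0 \<and> \<omega> j q \<le> 0 \<and> - ((1/2) ^ j) \<le> \<omega> j q"
        using local[of "l c"] False c unfolding \<Sigma>_def by blast
      obtain \<rho>0 where \<rho>0: "\<rho>0 > 0" "cball c \<rho>0 \<subseteq> {\<zeta>. l \<zeta> \<in> T}"
        using open_contains_cball_eq[OF ol[OF TJ(1)]] TJ(2) by blast
      have inT: "l \<zeta> \<in> T" if "dist c \<zeta> \<le> \<rho>0" for \<zeta> using \<rho>0(2) that by auto
      have sub\<Sigma>: "cball c \<rho>0 \<subseteq> \<Sigma>" using \<rho>0(2) TJ(3) unfolding \<Sigma>_def by blast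
      have sub\<Sigma>b: "ball c \<rho>0 \<subseteq> \<Sigma>" using sub\<Sigma> ball_subset_cball by blast
      define P where "P = (\<lambda>j r. 2 * pi * \<omega> j (l c) \<le> integral {0..2*pi} (\<lambda>t. \<omega> j (l (c + of_real r * cis t))))"
      have Pr: "P j r" if \<rho>: "ball c \<rho> \<subseteq> \<Sigma>" "0 < r" "r < \<rho>" and nz: "cmod (g j (l c)) \<le> exp (- \<mu> j) \<or> (\<forall>z\<in>ball c \<rho>. g j (l z) \<noteq> 0)"
        for j r \<rho>
      proof -
        have "2 * pi * ln (max (cmod (g j (l c))) (exp (- \<mu> j))) / \<mu> j
           \<le> integral {0..2*pi} (\<lambda>t. ln (max (cmod (g j (l (c + of_real r * cis t)))) (exp (- \<mu> j)))) / \<mu> j"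
          using \<mu>[of j] \<rho> nz
          by (intro divide_right_mono ln_max_norm_submean[of "\<lambda>\<zeta>. g j (l \<zeta>)" c \<rho>] holomorphic_on_subset[OF glh]) auto
        then show ?thesis unfolding P_def \<omega>_def by simp
      qed
      \<comment> \<open>From J on all g j are zero-free on one common disc. The finitely many
        earlier ones may vanish near c, so each of them gets its own radius.\<close>
      have "\<forall>\<^sub>F r in at_right 0. P j r" for j
      proof -
        obtain \<rho> where "\<rho> > 0" "ball c \<rho> \<subseteq> \<Sigma>" "cmod (g j (l c)) \<le> exp (- \<mu> j) \<or> (\<forall>z\<in>ball c \<rho>. g j (l z) \<noteq> 0)"
        proof (cases "g j (l c) = 0")
          case True
          then show thesis using that[of \<rho>0] \<rho>0(1) sub\<Sigma>b by simp
        next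
          case False
          have "open (\<Sigma> \<inter> (\<lambda>\<zeta>. g j (l \<zeta>)) -` (- {0}))"
            by (rule continuous_open_preimage[OF holomorphic_on_imp_continuous_on[OF glh] \<Sigma>]) auto
          moreover have "c \<in> \<Sigma> \<inter> (\<lambda>\<zeta>. g j (l \<zeta>)) -` (- {0})" using c False by auto
          ultimately obtain \<rho> where "\<rho> > 0" "ball c \<rho> \<subseteq> \<Sigma> \<inter> (\<lambda>\<zeta>. g j (l \<zeta>)) -` (- {0})"
            using open_contains_ball by blast
          then show thesis using that[of \<rho>] by auto
        qed
        then show ?thesis unfolding eventually_at_right_field using Pr by blast
      qed
      then have "\<forall>\<^sub>F r in at_right 0. \<forall>j\<in>{..<J}. P j r" by (intro eventually_ball_finite) auto
      then obtain \<rho>1 where \<rho>1: "\<rho>1 > 0" "\<And>j r. 0 < r \<Longrightarrow> r < \<rho>1 \<Longrightarrow> j < J \<Longrightarrow> P j r"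
        unfolding eventually_at_right_field by auto
      define \<rho> where "\<rho> = min \<rho>0 \<rho>1"
      have "submean_at (\<lambda>\<zeta>. u (l \<zeta>)) c r" if r: "0 < r" "r < \<rho>" for r
      proof -
        have PJ: "P j r" for j
        proof (cases "j < J")
          case True
          then show ?thesis using \<rho>1 r unfolding \<rho>_def by auto
        next
          case False
          show ?thesis
          proof (rule Pr[of \<rho>0])
            show "cmod (g j (l c)) \<le> exp (- \<mu> j) \<or> (\<forall>z\<in>ball c \<rho>0. g j (l z) \<noteq> 0)"
              using TJ(4)[of j] inT False by auto
          qed (use sub\<Sigma>b r in \<open>auto simp: \<rho>_def\<close>)
        qed
        have circ: "l (c + of_real r * cis t) \<in> T" for t
          using r by (intro inT) (auto simp: dist_norm norm_mult \<rho>_def)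
        have cl: "continuous_on {0..2*pi} (\<lambda>t. h (l (c + of_real r * cis t)))"
          if "continuous_on T h" for h :: "complex \<times> complex \<Rightarrow> real"
          by (rule continuous_on_compose2[OF that])
             (use circ in \<open>auto intro!: continuous_on_compose2[OF lc[of UNIV]] continuous_intros\<close>)
        have TO: "T \<subseteq> \<Omega>" using TJ(3) by auto
        have vT: "continuous_on T v" by (rule vc[OF TO, of J]) (use TJ(4) in auto)
        have \<omega>i: "(\<lambda>t. \<omega> j (l (c + of_real r * cis t))) integrable_on {0..2*pi}" for j
          by (intro integrable_continuous_interval cl continuous_on_subset[OF \<omega>c TO])
        have vi: "(\<lambda>t. v (l (c + of_real r * cis t))) integrable_on {0..2*pi}"
          by (intro integrable_continuous_interval cl vT)
        let ?I = "integral {0..2*pi} (\<lambda>t. v (l (c + of_real r * cis t)))"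
        \<comment> \<open>The mean inequality holds for finite sums. Replacing \<open>v\<close> by
          \<open>S n\<close> costs at most the geometric tail, which vanishes as n grows.\<close>
        have step: "2 * pi * v (l c) \<le> ?I + 4 * pi * (1/2) ^ n" if n: "n \<ge> J" for n
        proof -
          have "v (l c) \<le> S n (l c)" using tail[of J "l c" n] TJ n by auto
          then have "2 * pi * v (l c) \<le> 2 * pi * S n (l c)" by simp
          also have "\<dots> = (\<Sum>j<n. 2 * pi * \<omega> j (l c))" unfolding S_def by (simp add: sum_distrib_left)
          also have "\<dots> \<le> (\<Sum>j<n. integral {0..2*pi} (\<lambda>t. \<omega> j (l (c + of_real r * cis t))))"
            using PJ unfolding P_def by (intro sum_mono)
          also have "\<dots> = integral {0..2*pi} (\<lambda>t. S n (l (c + of_real r * cis t)))"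
            unfolding S_def by (intro integral_sum[symmetric] \<omega>i) auto
          also have "\<dots> \<le> integral {0..2*pi} (\<lambda>t. v (l (c + of_real r * cis t)) + 2 * (1/2) ^ n)"
          proof (rule integral_le)
            show "(\<lambda>t. S n (l (c + of_real r * cis t))) integrable_on {0..2*pi}"
              unfolding S_def by (intro integrable_sum \<omega>i) auto
            show "(\<lambda>t. v (l (c + of_real r * cis t)) + 2 * (1/2) ^ n) integrable_on {0..2*pi}"
              by (intro integrable_add vi integrable_const_ivl)
            show "S n (l (c + of_real r * cis t)) \<le> v (l (c + of_real r * cis t)) + 2 * (1/2) ^ n" for t
              using tail[of J "l (c + of_real r * cis t)" n] TJ(4)[OF _ circ] n by auto
          qed
          also have "\<dots> = ?I + 4 * pi * (1/2) ^ n"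
            by (subst integral_add[OF vi integrable_const_ivl]) simp
          finally show ?thesis .
        qed
        have "(\<lambda>n. ?I + 4 * pi * (1/2) ^ n) \<longlonglongrightarrow> ?I + 4 * pi * 0"
          by (intro tendsto_intros LIMSEQ_realpow_zero) auto
        then have "2 * pi * v (l c) \<le> ?I + 4 * pi * 0"
          by (rule LIMSEQ_le_const) (use step in blast)
        moreover have "u (l (c + of_real r * cis t)) = ereal (v (l (c + of_real r * cis t)))" for t
          using circ[of t] TJ(3) by (auto simp: u_def)
        ultimately show ?thesis
          using False by (intro submean_at_continuousI[OF _ _ cl[OF vT], of _ _ "v (l c)"]) (auto simp: u_def)
      qed
      moreover have "cball c \<rho> \<subseteq> \<Sigma>" using sub\<Sigma> unfolding \<rho>_def by auto
      moreover have "\<rho> > 0" using \<rho>0 \<rho>1 unfolding \<rho>_def by auto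
      ultimately show ?thesis by blast
    qed
    then have "subharmonic_on \<Sigma> (\<lambda>\<zeta>. u (l \<zeta>))"
      unfolding subharmonic_on_def using \<Sigma> ufin usc_on_eexp[OF lec ufin] by blast
    then show ?thesis unfolding \<Sigma>_def l_def .
  qed
  have "plurisubharmonic_on \<Omega> u"
    unfolding plurisubharmonic_on_def using \<Omega> ufin usc_on_eexp[OF ec ufin] slice by blast
  then have "continuous_psh_on \<Omega> u" unfolding continuous_psh_on_def using ec by blast
  moreover have "{p \<in> \<Omega>. u p = -\<infinity>} = E" using E unfolding u_def by auto
  ultimately show ?thesis by blast
qed

subsection \<open>Pluripolarity of the graph\<close>

lemma compact_exhaustion_interior:
  assumes D: "open D" "z0 \<in> D"
  obtains d where "d > 0" "\<forall>\<^sub>F j in sequentially. ball z0 d \<subseteq> {z. cmod z \<le> real j \<and> (\<forall>y\<in>-D. 1 / (real j + 1) \<le> dist z y)}"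
proof -
  obtain e where e: "e > 0" "ball z0 e \<subseteq> D" using D open_contains_ball by blast
  obtain J :: nat where J: "real J \<ge> max (cmod z0 + e) (2 / e)" using real_arch_simple by blast
  have "ball z0 (e/2) \<subseteq> {z. cmod z \<le> real j \<and> (\<forall>y\<in>-D. 1 / (real j + 1) \<le> dist z y)}" if j: "j \<ge> J" for j
  proof (intro subsetI CollectI conjI ballI)
    fix z assume z: "z \<in> ball z0 (e/2)"
    have jj: "real j \<ge> cmod z0 + e" "real j \<ge> 2 / e" using J j by auto
    have "cmod z \<le> cmod z0 + cmod (z - z0)" by (rule norm_triangle_sub)
    moreover have "cmod (z - z0) < e / 2" using z by (simp add: dist_norm norm_minus_commute)
    ultimately show "cmod z \<le> real j" using jj e by linarith
    fix y assume "y \<in> -D"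
    then have "dist z0 y \<ge> e" using e by force
    moreover have "dist z0 y \<le> dist z0 z + dist z y" by (rule dist_triangle)
    ultimately have "e / 2 \<le> dist z y" using z by simp
    moreover have "1 / (real j + 1) \<le> e / 2" using jj(2) e by (simp add: field_simps)
    ultimately show "1 / (real j + 1) \<le> dist z y" by linarith
  qed
  then show thesis using that[of "e/2"] e unfolding eventually_sequentially by auto
qed

lemma compact_exhaustion:
  fixes D :: "complex set"
  defines "X \<equiv> \<lambda>j. {z. cmod z \<le> real j \<and> (\<forall>y\<in>-D. 1 / (real j + 1) \<le> dist z y)}"
  shows "compact (X j)" "X j \<subseteq> D"
proof -
  have "X j = cball 0 (real j) \<inter> (\<Inter>y\<in>-D. {z. 1 / (real j + 1) \<le> dist z y})"
    unfolding X_def by auto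
  moreover have "closed (\<Inter>y\<in>-D. {z. 1 / (real j + 1) \<le> dist z y})"
    by (intro closed_INT ballI closed_Collect_le continuous_intros)
  ultimately show "compact (X j)" using compact_Int_closed[OF compact_cball] by metis
  have "\<not> 1 / (real j + 1) \<le> 0" by (simp add: not_le)
  then show "X j \<subseteq> D" unfolding X_def by force
qed

theorem theorem2p1:
  fixes D K :: "complex set" and f :: "complex \<Rightarrow> complex"
  assumes "open D" and "connected D" and "D \<noteq> {}"
    and "compact K" and "K \<subseteq> D" and "polar K"
    and "f holomorphic_on (D - K)"
  shows "\<exists>u. continuous_psh_on (D \<times> UNIV) u \<and>
           {p \<in> D \<times> UNIV. u p = -\<infinity>} = {(z, f z) | z. z \<in> D - K} \<union> (K \<times> UNIV)"
proof -
  note D = \<open>open D\<close> and K = \<open>compact K\<close> \<open>polar K\<close> \<open>K \<subseteq> D\<close> and f = \<open>f holomorphic_on (D - K)\<close>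
  have DK: "open (D - K)" using D K by (intro open_Diff compact_imp_closed)
  obtain R1 where R1: "\<And>z. z \<in> K \<Longrightarrow> cmod z \<le> R1"
    using compact_imp_bounded[OF K(1)] bounded_iff by blast
  define R0 where "R0 = max 1 R1"
  have R0: "R0 \<ge> 1" "\<And>z. z \<in> K \<Longrightarrow> cmod z \<le> R0" using R1 unfolding R0_def by force+
  obtain e0 where e0: "e0 > 0" "\<And>k e. k \<in> K \<Longrightarrow> e \<le> e0 \<Longrightarrow> cball k e \<subseteq> D"
  proof (cases "K = {}")
    case True
    then show thesis using that[of 1] by auto
  next
    case False
    obtain e where e: "e > 0" "{x. infdist x K \<le> e} \<subseteq> D"
      using compact_in_open_separated[OF False K(1) D K(3)] by metis
    have "infdist x K \<le> e" if "k \<in> K" "dist k x \<le> e" for k x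
      using infdist_le[OF that(1), of x] that(2) by (simp add: dist_commute)
    then have "cball k e' \<subseteq> D" if "k \<in> K" "e' \<le> e" for k e' using that e(2) by force
    then show thesis using that e(1) by blast
  qed
  define X where "X = (\<lambda>j::nat. {z. cmod z \<le> real j \<and> (\<forall>y\<in>-D. 1 / (real j + 1) \<le> dist z y)})"
  have X: "compact (X j)" "X j \<subseteq> D" for j unfolding X_def by (rule compact_exhaustion)+
  \<comment> \<open>The factor 2^j pays for the weight 1 / 2^j that makes the series converge. What
    remains is exp (-(j + 1)), which eventually lies below every lower bound of order 1 / j.\<close>
  define \<epsilon> where "\<epsilon> = (\<lambda>j::nat. exp (- (real (j + 1) * 2 ^ j)))"
  have \<epsilon>: "0 < \<epsilon> j" "\<epsilon> j < 1" for j unfolding \<epsilon>_def by auto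
  have \<epsilon>small: "\<forall>\<^sub>F j in sequentially. \<epsilon> j < c" if c: "c > 0" for c
  proof -
    have "\<epsilon> j \<le> inverse (real (Suc j))" for j
    proof -
      have "real (Suc j) = real (j + 1) * 1" by simp
      also have "\<dots> \<le> real (j + 1) * 2 ^ j" by (intro mult_left_mono) auto
      also have "\<dots> \<le> 1 + real (j + 1) * 2 ^ j" by (rule add_increasing) auto
      also have "\<dots> \<le> exp (real (j + 1) * 2 ^ j)" by (rule exp_ge_add_one_self)
      finally have "real (Suc j) \<le> exp (real (j + 1) * 2 ^ j)" .
      then show ?thesis unfolding \<epsilon>_def exp_minus by (intro le_imp_inverse_le) auto
    qed
    moreover have "\<forall>\<^sub>F j in sequentially. inverse (real (Suc j)) < c"
      using order_tendstoD(2)[OF LIMSEQ_inverse_real_of_nat c] .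
    ultimately show ?thesis by (auto elim!: eventually_mono intro: le_less_trans)
  qed
  define spec where "spec = (\<lambda>j N Q G.
    (\<forall>z w. z \<in> X j \<longrightarrow> cmod w \<le> real j \<longrightarrow> cmod (Q z * w - G z) \<le> (2 * (cmod z + R0)) ^ N) \<and>
    (\<forall>z. z \<in> D \<longrightarrow> (\<forall>k\<in>K. \<epsilon> j < dist z k) \<longrightarrow> cmod (Q z * f z - G z) \<le> (2 * \<epsilon> j) ^ N) \<and>
    (\<forall>z w. z \<in> K \<longrightarrow> cmod w \<le> real j \<longrightarrow> cmod (Q z * w - G z) \<le> (2 * \<epsilon> j) ^ N) \<and>
    (\<forall>z \<sigma>. 0 < \<sigma> \<longrightarrow> \<sigma> < 1 \<longrightarrow> (\<forall>k\<in>K. \<sigma> < dist z k) \<longrightarrow> \<sigma> ^ N \<le> cmod (Q z)))"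
  have "\<exists>N Q G. N \<ge> (1::nat) \<and> Q holomorphic_on UNIV \<and> G holomorphic_on D \<and> (\<epsilon> j \<le> e0 \<longrightarrow> spec j N Q G)" for j
  proof (cases "\<epsilon> j \<le> e0")
    case True
    have "\<And>k. k \<in> K \<Longrightarrow> cball k (\<epsilon> j) \<subseteq> D" using e0(2) True by blast
    then obtain N Q G where "N \<ge> (1::nat)" "Q holomorphic_on UNIV" "G holomorphic_on D" "spec j N Q G"
      using approximation_step[OF D K f R0 X[of j], of "real j" "\<epsilon> j"] \<epsilon>[of j]
      unfolding spec_def by (smt (verit) of_nat_0_le_iff)
    then show ?thesis by blast
  next
    case False
    then show ?thesis
      by (intro exI[of _ 1] exI[of _ "\<lambda>_. 0"]) auto
  qed
  then obtain N Q G where N: "\<And>j. N j \<ge> (1::nat)" and Q: "\<And>j. Q j holomorphic_on UNIV"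
      and G: "\<And>j. G j holomorphic_on D" and sp: "\<And>j. \<epsilon> j \<le> e0 \<Longrightarrow> spec j (N j) (Q j) (G j)"
    by metis
  have ev: "\<forall>\<^sub>F j in sequentially. spec j (N j) (Q j) (G j)"
    using \<epsilon>small[OF e0(1)] by (rule eventually_mono) (use sp in auto)
  \<comment> \<open>On \<open>X j\<close>, where |z| is at most j, division by \<open>C j\<close>
    brings the upper bound down to 1. Below, \<open>\<mu> j\<close> is the number with exp (- \<mu>
    j) = \<epsilon> j ^ N j.\<close>
  define C where "C j = (2 * (real j + R0)) ^ N j" for j
  define g where "g = (\<lambda>j p. (Q j (fst p) * snd p - G j (fst p)) / of_real (C j))"
  define \<mu> where "\<mu> = (\<lambda>j. real (N j) * (real (j + 1) * 2 ^ j))"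
  have c0: "2 * (real j + R0) \<ge> 2" for j using R0 by simp
  have C: "C j > 0" for j unfolding C_def using c0[of j] by (intro zero_less_power) linarith
  have ng: "cmod (g j (z, w)) = cmod (Q j z * w - G j z) / (2 * (real j + R0)) ^ N j" for j z w
    unfolding g_def C_def[symmetric] using C[of j] by (simp add: norm_divide)
  have e\<mu>: "exp (- \<mu> j) = \<epsilon> j ^ N j" for j
    unfolding \<mu>_def \<epsilon>_def by (simp add: exp_of_nat_mult[symmetric])
  define E where "E = {(z, f z) | z. z \<in> D - K} \<union> (K \<times> UNIV)"
  have large: "\<forall>\<^sub>F j in sequentially. x \<le> real j" for x
    using filterlim_real_sequentially unfolding filterlim_at_top by blast
  \<comment> \<open>Since \<open>C j\<close> is at least 2 ^ N j, the normalisation cancels the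
    factor 2 in (2 \<epsilon> j) ^ N j.\<close>
  have small_g: "cmod (g j (z, w)) \<le> exp (- \<mu> j)" if "cmod (Q j z * w - G j z) \<le> (2 * \<epsilon> j) ^ N j" for j z w
  proof -
    have "cmod (g j (z, w)) \<le> (2 * \<epsilon> j) ^ N j / 2 ^ N j"
      unfolding ng using that c0[of j] \<epsilon>[of j] by (intro frac_le power_mono) auto
    then show ?thesis unfolding e\<mu> by (simp add: power_mult_distrib)
  qed
  have sep: "\<exists>d>0. \<forall>k\<in>K. d \<le> dist z k" if "z \<notin> K" for z
    using separate_point_closed[OF compact_imp_closed[OF K(1)] that] by blast
  have "\<exists>u. continuous_psh_on (D \<times> UNIV) u \<and> {p \<in> D \<times> UNIV. u p = -\<infinity>} = E"
  proof (rule continuous_psh_from_logarithms[of _ _ \<mu> g])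
    show "open (D \<times> (UNIV :: complex set))" using D by (intro open_Times) auto
    show "E \<subseteq> D \<times> UNIV" unfolding E_def using K by auto
    show "\<mu> j > 0" for j unfolding \<mu>_def using N[of j] by simp
    show "continuous_on (D \<times> UNIV) (g j)" for j
      unfolding g_def using C[of j]
      by (intro continuous_intros continuous_on_compose2[OF holomorphic_on_imp_continuous_on[OF Q]]
          continuous_on_compose2[OF holomorphic_on_imp_continuous_on[OF G]]) auto
    show "(\<lambda>\<zeta>. g j (fst a + \<zeta> * fst b, snd a + \<zeta> * snd b)) holomorphic_on
            {\<zeta>. (fst a + \<zeta> * fst b, snd a + \<zeta> * snd b) \<in> D \<times> UNIV}" for j a b
    proof -
      let ?S = "{\<zeta>. (fst a + \<zeta> * fst b, snd a + \<zeta> * snd b) \<in> D \<times> UNIV}"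
      have l: "(\<lambda>\<zeta>. fst a + \<zeta> * fst b) holomorphic_on ?S" by (intro holomorphic_intros)
      have "(\<lambda>\<zeta>. Q j (fst a + \<zeta> * fst b)) holomorphic_on ?S" "(\<lambda>\<zeta>. G j (fst a + \<zeta> * fst b)) holomorphic_on ?S"
        using holomorphic_on_compose_gen[OF l Q[of j]] holomorphic_on_compose_gen[OF l G[of j]] by (auto simp: o_def)
      then show ?thesis unfolding g_def fst_conv snd_conv using C[of j] by (intro holomorphic_intros) auto
    qed
    show "\<exists>T. open T \<and> p \<in> T \<and> (\<forall>\<^sub>F j in sequentially. \<forall>q\<in>T \<inter> (D \<times> UNIV). cmod (g j q) \<le> 1)"
      if pD: "p \<in> D \<times> UNIV" for p
    proof -
      obtain z0 w0 where p: "p = (z0, w0)" "z0 \<in> D" using pD by auto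
      obtain d where d: "d > 0" "\<forall>\<^sub>F j in sequentially. ball z0 d \<subseteq> X j"
        using compact_exhaustion_interior[OF D p(2)] unfolding X_def by blast
      have "\<forall>\<^sub>F j in sequentially. \<forall>q\<in>(ball z0 d \<times> ball w0 1) \<inter> (D \<times> UNIV). cmod (g j q) \<le> 1"
        using ev d(2) large[of "cmod w0 + 1"]
      proof eventually_elim
        case (elim j)
        show ?case
        proof (rule ballI)
          fix q assume q: "q \<in> (ball z0 d \<times> ball w0 1) \<inter> (D \<times> UNIV)"
          obtain z w where zw: "q = (z, w)" by (cases q)
          have z: "z \<in> X j" using q zw elim by auto
          have "cmod w \<le> cmod w0 + cmod (w - w0)" by (rule norm_triangle_sub)
          moreover have "cmod (w - w0) < 1" using q zw by (simp add: dist_norm norm_minus_commute)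
          ultimately have "cmod w \<le> real j" using elim(3) by linarith
          then have "cmod (Q j z * w - G j z) \<le> (2 * (cmod z + R0)) ^ N j"
            using elim(1) z unfolding spec_def by blast
          also have "\<dots> \<le> (2 * (real j + R0)) ^ N j"
            using z R0 by (intro power_mono) (auto simp: X_def)
          finally show "cmod (g j q) \<le> 1" unfolding zw ng using c0[of j] by (simp add: divide_le_eq_1)
        qed
      qed
      then show ?thesis using p d(1) by (intro exI[of _ "ball z0 d \<times> ball w0 1"]) (auto intro: open_Times)
    qed
    show "\<forall>\<^sub>F j in sequentially. cmod (g j p) \<le> exp (- \<mu> j)" if "p \<in> E" for p
    proof -
      obtain z w where p: "p = (z, w)" by (cases p)
      show ?thesis
      proof (cases "z \<in> K")
        case True
        show ?thesis using ev large[of "cmod w"]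
        proof eventually_elim
          case (elim j)
          then show ?case using True small_g[of j z w] unfolding p spec_def by blast
        qed
      next
        case False
        then have zw: "z \<in> D" "w = f z" using that p unfolding E_def by auto
        obtain d where d: "d > 0" "\<forall>k\<in>K. d \<le> dist z k" using sep[OF False] by blast
        show ?thesis using ev \<epsilon>small[OF d(1)]
        proof eventually_elim
          case (elim j)
          then have "\<forall>k\<in>K. \<epsilon> j < dist z k" using d by force
          then show ?case using elim(1) zw small_g[of j z w] unfolding p spec_def by blast
        qed
      qed
    qed
    show "\<exists>T. open T \<and> p \<in> T \<and>
        (\<forall>\<^sub>F j in sequentially. \<forall>q\<in>T \<inter> (D \<times> UNIV). exp (- \<mu> j / 2 ^ j) \<le> cmod (g j q))"
      if "p \<in> D \<times> UNIV - E" for p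
    proof -
      obtain z0 w0 where p: "p = (z0, w0)" by (cases p)
      have z0: "z0 \<in> D - K" and w0: "w0 \<noteq> f z0" using that p unfolding E_def by auto
      obtain d where d: "d > 0" "\<forall>k\<in>K. d \<le> dist z0 k" using sep z0 by blast
      \<comment> \<open>One constant for three purposes: points within \<sigma> of \<open>z0\<close>
        stay farther than \<sigma> from K, |w - f z| > \<sigma> holds near p, and \<sigma> < 1
        permits the lower bound for |Q j|.\<close>
      define \<sigma> where "\<sigma> = min (1/2) (min (d/2) (cmod (w0 - f z0) / 2))"
      have \<sigma>: "0 < \<sigma>" "\<sigma> < 1" "\<sigma> \<le> d / 2" "\<sigma> < cmod (w0 - f z0)"
        using d w0 unfolding \<sigma>_def by (auto simp: min_less_iff_disj)
      have \<sigma>4: "\<sigma>\<^sup>2 / 4 > 0" using \<sigma>(1) by simp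
      define T where "T = {p \<in> (D - K) \<times> UNIV. \<sigma> < cmod (snd p - f (fst p))} \<inter> (ball z0 \<sigma> \<times> UNIV)"
      have "continuous_on ((D - K) \<times> UNIV) (\<lambda>p. cmod (snd p - f (fst p)))"
        by (intro continuous_intros continuous_on_compose2[OF holomorphic_on_imp_continuous_on[OF f]]) auto
      then have "open ((D - K) \<times> UNIV \<inter> (\<lambda>p. cmod (snd p - f (fst p))) -` {\<sigma><..})"
        using DK by (intro continuous_open_preimage open_Times) auto
      moreover have "(D - K) \<times> UNIV \<inter> (\<lambda>p. cmod (snd p - f (fst p))) -` {\<sigma><..}
          = {p \<in> (D - K) \<times> UNIV. \<sigma> < cmod (snd p - f (fst p))}" by auto
      ultimately have T: "open T" unfolding T_def by (auto intro!: open_Int open_Times)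
      have pT: "p \<in> T" unfolding T_def p using z0 \<sigma> by auto
      have "\<forall>\<^sub>F j in sequentially. \<forall>q\<in>T \<inter> (D \<times> UNIV). exp (- \<mu> j / 2 ^ j) \<le> cmod (g j q)"
        using ev \<epsilon>small[OF \<sigma>4] \<epsilon>small[OF \<sigma>(1)] large[of "8 * R0 / \<sigma>\<^sup>2"]
      proof eventually_elim
        case (elim j)
        show ?case
        proof (rule ballI)
          fix q assume q: "q \<in> T \<inter> (D \<times> UNIV)"
          obtain z w where zw: "q = (z, w)" by (cases q)
          have z: "z \<in> D - K" "\<sigma> < cmod (w - f z)" "dist z0 z < \<sigma>" using q zw unfolding T_def by auto
          have far: "\<sigma> < dist z k" if "k \<in> K" for k
            using d(2) that z(3) \<sigma>(3) dist_triangle[of z0 k z] by force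
          have Qlb: "\<sigma> ^ N j \<le> cmod (Q j z)" using elim(1) \<sigma>(1,2) far unfolding spec_def by blast
          have "\<epsilon> j < dist z k" if "k \<in> K" for k using far[OF that] elim(3) by simp
          then have "cmod (Q j z * f z - G j z) \<le> (2 * \<epsilon> j) ^ N j" using elim(1) z unfolding spec_def by blast
          also have "\<dots> \<le> (\<sigma> * (\<sigma> / 2)) ^ N j"
            using elim(2) \<epsilon>[of j] by (intro power_mono) (auto simp: power2_eq_square)
          also have "\<dots> = \<sigma> ^ N j * (\<sigma> / 2) ^ N j" by (rule power_mult_distrib)
          finally have err: "cmod (Q j z * f z - G j z) \<le> \<sigma> ^ N j * (\<sigma> / 2) ^ N j" .
          \<comment> \<open>As N j is at least 1, the error is at most half of the main term
            \<sigma> ^ N j * \<sigma>. The remaining half is bounded below by an N j-th power, so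
            that only bases have to be compared afterwards.\<close>
          have half: "(\<sigma> / 2) ^ N j \<le> (\<sigma> / 2) ^ 1" using \<sigma> N[of j] by (intro power_decreasing) auto
          have "\<sigma> ^ N j * \<sigma> \<le> cmod (Q j z) * cmod (w - f z)" using Qlb z(2) \<sigma>(1) by (intro mult_mono) auto
          also have "\<dots> = cmod ((Q j z * w - G j z) - (Q j z * f z - G j z))"
            by (simp add: norm_mult[symmetric] algebra_simps)
          also have "\<dots> \<le> cmod (Q j z * w - G j z) + cmod (Q j z * f z - G j z)" by (rule norm_triangle_ineq4)
          finally have "\<sigma> ^ N j * \<sigma> - \<sigma> ^ N j * (\<sigma> / 2) ^ N j \<le> cmod (Q j z * w - G j z)" using err by linarith
          moreover have "\<sigma> ^ N j * (\<sigma> / 2) ^ N j \<le> \<sigma> ^ N j * (\<sigma> / 2)"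
            using half \<sigma>(1) by (intro mult_left_mono) auto
          ultimately have "\<sigma> ^ N j * (\<sigma> / 2) ^ N j \<le> cmod (Q j z * w - G j z)"
            by (simp add: field_simps)
          then have "\<sigma> ^ N j * (\<sigma> / 2) ^ N j / (2 * (real j + R0)) ^ N j \<le> cmod (g j q)"
            unfolding zw ng using c0[of j] by (intro divide_right_mono) auto
          then have lb: "(\<sigma>\<^sup>2 / 2 / (2 * (real j + R0))) ^ N j \<le> cmod (g j q)"
            by (simp only: power_mult_distrib[symmetric] power_divide[symmetric] power2_eq_square times_divide_eq_right)
          \<comment> \<open>The condition 8 R0 / \<sigma>^2 \<le> j, combined with exp x \<ge> x^2 /
            2, lets the exponential beat the linear growth of the normalisation.\<close>
          have "exp (- real (j + 1)) \<le> \<sigma>\<^sup>2 / 2 / (2 * (real j + R0))"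
          proof -
            have j1: "real j + R0 \<le> R0 * (real j + 1)" using R0(1) mult_left_mono[of 1 R0 "real j"] by (simp add: algebra_simps)
            have "8 * R0 \<le> \<sigma>\<^sup>2 * (real j + 1)" 
              using elim(4) \<sigma>(1) by (auto simp: field_simps intro: add_increasing)
            then have "8 * R0 * (real j + 1) \<le> \<sigma>\<^sup>2 * (real j + 1) * (real j + 1)"
              by (intro mult_right_mono) auto
            moreover have "8 * (real j + R0) \<le> 8 * R0 * (real j + 1)" using j1 by simp
            ultimately have "8 * (real j + R0) \<le> \<sigma>\<^sup>2 * (real j + 1) * (real j + 1)" by (rule order_trans[rotated])
            then have "4 * (real j + R0) \<le> \<sigma>\<^sup>2 * (real j + 1) * (real j + 1) / 2" by linarith
            also have "\<dots> = \<sigma>\<^sup>2 * ((real j + 1)\<^sup>2 / 2)" by (simp add: power2_eq_square)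
            also have "\<dots> \<le> \<sigma>\<^sup>2 * exp (real j + 1)"
              using exp_lower_Taylor_quadratic[of "real j + 1"] by (intro mult_left_mono) auto
            finally have "exp (- real (j + 1)) * (4 * (real j + R0)) \<le> exp (- real (j + 1)) * (\<sigma>\<^sup>2 * exp (real j + 1))"
              by (intro mult_left_mono) auto
            also have "\<dots> = \<sigma>\<^sup>2 * (exp (- real (j + 1)) * exp (real j + 1))" by (simp only: mult.left_commute)
            also have "exp (- real (j + 1)) * exp (real j + 1) = 1" by (simp add: mult_exp_exp)
            finally have "exp (- real (j + 1)) \<le> \<sigma>\<^sup>2 / (4 * (real j + R0))"
              using c0[of j] by (subst pos_le_divide_eq) auto
            then show ?thesis by simp
          qed
          then have "exp (- real (j + 1)) ^ N j \<le> (\<sigma>\<^sup>2 / 2 / (2 * (real j + R0))) ^ N j"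
            by (intro power_mono) auto
          moreover have "\<mu> j / 2 ^ j = real (N j) * real (j + 1)" unfolding \<mu>_def by simp
          then have "- \<mu> j / 2 ^ j = real (N j) * (- real (j + 1))" by (simp only: minus_divide_left[symmetric] mult_minus_right)
          then have "exp (- \<mu> j / 2 ^ j) = exp (- real (j + 1)) ^ N j" by (simp only: exp_of_nat_mult)
          ultimately show "exp (- \<mu> j / 2 ^ j) \<le> cmod (g j q)" using lb by linarith
        qed
      qed
      then show ?thesis using T pT by blast
    qed
  qed
  then show ?thesis unfolding E_def .
qed

end
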